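(* Consider the fourth order finite difference scheme in one dimension: for odd $i$ ($i=1,3,5,\dots,N$), $$\begin{aligned}&\mathcal M_ig_i^{n+1}+\Delta t\frac{-u_{i-2}g_{i-2}^{n+1}+4u_{i-1}g_{i-1}^{n+1}-4u_{i+1}g_{i+1}^{n+1}+u_{i+2}g_{i+2}^{n+1}}{4h}\\&+\Delta t\frac{D(3\mathcal M_{i-2}-4\mathcal M_{i-1}+3\mathcal M_i)g_{i-2}^{n+1}-D(4\mathcal M_{i-2}+12\mathcal M_i)g_{i-1}^{n+1}}{8h^2}\\&+\Delta t\frac{D(\mathcal M_{i-2}+4\mathcal M_{i-1}+18\mathcal M_i+4\mathcal M_{i+1}+\mathcal M_{i+2})g_i^{n+1}}{8h^2}\\&+\Delta t\frac{-D(12\mathcal M_i+4\mathcal M_{i+2})g_{i+1}^{n+1}+D(3\mathcal M_i-4\mathcal M_{i+1}+3\mathcal M_{i+2})g_{i+2}^{n+1}}{8h^2}=\mathcal M_ig_i^n,\end{aligned}$$ and for even $i$ ($i=2,4,\dots,N-1$), $$\mathcal M_ig_i^{n+1}+\Delta t\frac{u_{i-1}g_{i-1}^{n+1}-u_{i+1}g_{i+1}^{n+1}}{2h}+\Delta t\frac{-D(3\mathcal M_{i-1}+\mathcal M_{i+1})g_{i-1}^{n+1}+4D(\mathcal M_{i-1}+\mathcal M_{i+1})g_i^{n+1}-D(\mathcal M_{i-1}+3\mathcal M_{i+1})g_{i+1}^{n+1}}{4h^2}=\mathcal M_ig_i^n.$$ Suppose that: (a) $\mathcal M_i+\Delta t\,\dfrac{-u_{i-2}+4u_{i-1}-4u_{i+1}+u_{i+2}}{4h}>0$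 for odd $i$, and $\mathcal M_i+\Delta t\,\dfrac{u_{i-1}-u_{i+1}}{2h}>0$ for even $i$; (b) $h\max\{|u_{i-2}|,|u_{i-1}|,|u_i|\}\le\frac14D\min\{\mathcal M_{i-2},\mathcal M_{i-1},\mathcal M_i\}$ for odd $i$ with $3\le i\le N$; (c) $h\max_{[x_{i-2},x_i]}|\mathcal M'|\le0.075\min\{\mathcal M_{i-2},\mathcal M_{i-1},\mathcal M_i\}$ for odd $i$ with $3\le i\le N$; (d) $\dfrac{\Delta t}{h^2}\ge\dfrac{50}{D}$. Then the coefficient matrix for the unknown vector $\vec g^{\,n+1}$ satisfies Lorenz's conditions, so it is a product of two M-matrices and thus monotone. In particular, in one dimension, for a discrete divergence free velocity field $u$ (which is constant), the coefficient matrix is monotone under the constraints $\frac{\Delta t}{h^2}\ge\frac{50}{D}$ and, for odd $i$ (with $1\le i\le N-2$), $h\max\{|u_i|,|u_{i+1}|,|u_{i+2}|\}\le\frac14D\min\{\mathcal M_i,\mathcal M_{i+1},\mathcal M_{i+2}\}$ and $h\max_{[x_i,x_{i+2}]}|\mathcal M'|\le0.075\min\{\mathcal M_i,\mathcal M_{i+1},\mathcal M_{i+2}\}$.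
   Context: $\Omega=[-L,L]$ is partitioned into $k\ge1$ intervals of length $2h$; the grid is $-L=x_1<\dots<x_N=L$, uniform with spacing $h$, $N=2k+1$. $D>0$ is a constant, $\Delta t>0$. $\mathcal M\in C^1([-L,L])$ is a given function with $\mathcal M\ge\epsilon_0>0$, $\mathcal M_i=\mathcal M(x_i)$; $u_i=u(x_i)$ are point values of a given velocity with $u_1=u_N=0$ (boundary condition $\vec u\cdot\vec n=0$). Ghost values: $g_{-1}:=g_3$, $g_0:=g_2$, $g_{N+1}:=g_{N-1}$, $g_{N+2}:=g_{N-2}$, likewise for $\mathcal M$; and $u_{-1}:=-u_3$, $u_0:=-u_2$, $u_{N+1}:=-u_{N-1}$, $u_{N+2}:=-u_{N-2}$. These are substituted so that the scheme is an $N\times N$ linear system. Matrix inequalities are entrywise. A square matrix is monotone if it is invertible with entrywise nonnegative inverse. A (nonsingular) M-matrix is a matrix $sI-B$ with $B\ge0$ and $s$ greater than the spectral radius of $B$. Lorenz's conditions for $A=(a_{ij})\in\mathbb R^{m\times m}$: let $A_d$ be the diagonal part of $A$, $A_a^+$ the matrix of positive off-diagonal entries, $A_a^-=A-A_d-A_a^+$. There is a decomposition $A_a^-=A^z+A^s$ with $A^z\le0$, $A^s\le0$ such that (1) $A_d+A^z$ is a nonsingular M-matrix; (2) $A_a^+\le A^zA_d^{-1}A^s$; (3) there is a nonzero vector $\vec e\ge0$ with $A\vec e\ge0$ such that $A^z$ or $A^s$ connects $\mathcal N^0=\{i:(A\vec e)_i=0\}$ with $\mathcal N^+=\{i:(A\vec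 e)_i>0\}$. Here a matrix $C=(c_{ij})$ connects $\mathcal N_1$ with $\mathcal N_2$ if for every $i_0\in\mathcal N_1$ there exist $i_r\in\mathcal N_2$ and indices $i_1,\dots,i_{r-1}$ with $c_{i_{k-1}i_k}\ne0$ for $k=1,\dots,r$ (vacuously true if $\mathcal N_1=\emptyset$). *)

theory Defs
  imports Complex_Main "Jordan_Normal_Form.Spectral_Radius"
begin

section \<open>Monotone matrices, M-matrices and Lorenz's conditions\<close>

text \<open>Inequalities between matrices and between vectors are the entrywise orders of
  the matrix library; they include equality of the dimensions.\<close>

definition monotone_mat :: "real mat \<Rightarrow> bool" where
  "monotone_mat A \<longleftrightarrow> square_mat A \<and>
     (\<exists>B \<in> carrier_mat (dim_row A) (dim_row A).
        inverts_mat A B \<and> inverts_mat B A \<and> 0\<^sub>m (dim_row A) (dim_row A) \<le> B)"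

definition nonsing_M_matrix :: "real mat \<Rightarrow> bool" where
  "nonsing_M_matrix A \<longleftrightarrow> square_mat A \<and>
     (\<exists>s. \<exists>B \<in> carrier_mat (dim_row A) (dim_row A).
        0\<^sub>m (dim_row A) (dim_row A) \<le> B \<and>
        spectral_radius (map_mat complex_of_real B) < s \<and>
        A = s \<cdot>\<^sub>m 1\<^sub>m (dim_row A) - B)"

definition diag_part :: "real mat \<Rightarrow> real mat" where
  "diag_part A = mat (dim_row A) (dim_col A) (\<lambda>(i, j). if i = j then A $$ (i, j) else 0)"

definition pos_offdiag :: "real mat \<Rightarrow> real mat" where
  "pos_offdiag A = mat (dim_row A) (dim_col A)
     (\<lambda>(i, j). if i \<noteq> j \<and> 0 < A $$ (i, j) then A $$ (i, j) else 0)"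

definition neg_offdiag :: "real mat \<Rightarrow> real mat" where
  "neg_offdiag A = A - diag_part A - pos_offdiag A"

definition connects :: "real mat \<Rightarrow> nat set \<Rightarrow> nat set \<Rightarrow> bool" where
  "connects C N1 N2 \<longleftrightarrow>
     (\<forall>i0 \<in> N1. \<exists>r \<ge> 1. \<exists>p :: nat \<Rightarrow> nat.
        p 0 = i0 \<and> p r \<in> N2 \<and> (\<forall>l \<le> r. p l < dim_row C) \<and>
        (\<forall>l \<in> {1..r}. C $$ (p (l - 1), p l) \<noteq> 0))"

definition lorenz_conditions :: "real mat \<Rightarrow> bool" where
  "lorenz_conditions A \<longleftrightarrow> square_mat A \<and>
     (let m = dim_row A in
      \<exists>Az \<in> carrier_mat m m. \<exists>As \<in> carrier_mat m m.
        neg_offdiag A = Az + As \<and> Az \<le> 0\<^sub>m m m \<and> As \<le> 0\<^sub>m m m \<and>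
        nonsing_M_matrix (diag_part A + Az) \<and>
        (\<exists>Ad_inv \<in> carrier_mat m m.
           inverts_mat (diag_part A) Ad_inv \<and> inverts_mat Ad_inv (diag_part A) \<and>
           pos_offdiag A \<le> Az * Ad_inv * As) \<and>
        (\<exists>e \<in> carrier_vec m.
           e \<noteq> 0\<^sub>v m \<and> 0\<^sub>v m \<le> e \<and> 0\<^sub>v m \<le> A *\<^sub>v e \<and>
           (let N0 = {i. i < m \<and> (A *\<^sub>v e) $ i = 0};
                Np = {i. i < m \<and> (A *\<^sub>v e) $ i > 0}
            in connects Az N0 Np \<or> connects As N0 Np)))"


section \<open>The finite difference scheme\<close>

text \<open>Grid functions are indexed by integers, of which \<open>1, \<dots>, N\<close> are the grid points and
  \<open>-1, 0, N + 1, N + 2\<close> the ghost points. The reflections below send \<open>-1, 0, N + 1, N + 2\<close> to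
  \<open>3, 2, N - 1, N - 2\<close>.\<close>

definition reflect :: "int \<Rightarrow> int \<Rightarrow> int" where
  "reflect N i = (if i < 1 then 2 - i else if i > N then 2 * N - i else i)"

definition ghost_even :: "int \<Rightarrow> (int \<Rightarrow> real) \<Rightarrow> int \<Rightarrow> real" where
  "ghost_even N v i = v (reflect N i)"

definition ghost_odd :: "int \<Rightarrow> (int \<Rightarrow> real) \<Rightarrow> int \<Rightarrow> real" where
  "ghost_odd N v i = (if 1 \<le> i \<and> i \<le> N then v i else - v (reflect N i))"

text \<open>Left-hand side of the \<open>i\<close>-th equation of the scheme; \<open>M\<close>, \<open>u\<close> and the new time level \<open>g\<close>
  are grid functions already extended to the ghost points.\<close>

definition scheme_lhs ::
  "real \<Rightarrow> real \<Rightarrow> real \<Rightarrow> (int \<Rightarrow> real) \<Rightarrow> (int \<Rightarrow> real) \<Rightarrow> (int \<Rightarrow> real) \<Rightarrow> int \<Rightarrow> real" where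
  "scheme_lhs D dt h M u g i =
    (if odd i then
       M i * g i
       + dt * ((- u (i-2) * g (i-2) + 4 * u (i-1) * g (i-1)
                - 4 * u (i+1) * g (i+1) + u (i+2) * g (i+2)) / (4 * h))
       + dt * ((D * (3 * M (i-2) - 4 * M (i-1) + 3 * M i) * g (i-2)
                - D * (4 * M (i-2) + 12 * M i) * g (i-1)) / (8 * h\<^sup>2))
       + dt * (D * (M (i-2) + 4 * M (i-1) + 18 * M i + 4 * M (i+1) + M (i+2)) * g i / (8 * h\<^sup>2))
       + dt * ((- D * (12 * M i + 4 * M (i+2)) * g (i+1)
                + D * (3 * M i - 4 * M (i+1) + 3 * M (i+2)) * g (i+2)) / (8 * h\<^sup>2))
     else
       M i * g i
       + dt * ((u (i-1) * g (i-1) - u (i+1) * g (i+1)) / (2 * h))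
       + dt * ((- D * (3 * M (i-1) + M (i+1)) * g (i-1)
                + 4 * D * (M (i-1) + M (i+1)) * g i
                - D * (M (i-1) + 3 * M (i+1)) * g (i+1)) / (4 * h\<^sup>2)))"

text \<open>The left-hand side is linear in the new values, so column \<open>j\<close> of the coefficient matrix is
  the left-hand side at the \<open>j\<close>-th unit vector, with the ghost values of the unknown
  substituted. Matrix indices start at 0, grid indices at 1.\<close>

definition coeff_mat ::
  "nat \<Rightarrow> real \<Rightarrow> real \<Rightarrow> real \<Rightarrow> (int \<Rightarrow> real) \<Rightarrow> (int \<Rightarrow> real) \<Rightarrow> real mat" where
  "coeff_mat N D dt h M u = mat N N (\<lambda>(i, j).
     scheme_lhs D dt h M u
       (ghost_even (int N) (\<lambda>l. if l = int j + 1 then 1 else 0)) (int i + 1))"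

text \<open>The discrete divergence of \<open>u\<close> occurring in the scheme: minus its convection term
  at \<open>g = 1\<close>.\<close>

definition discrete_div :: "real \<Rightarrow> (int \<Rightarrow> real) \<Rightarrow> int \<Rightarrow> real" where
  "discrete_div h u i =
    (if odd i then (u (i-2) - 4 * u (i-1) + 4 * u (i+1) - u (i+2)) / (4 * h)
     else (u (i+1) - u (i-1)) / (2 * h))"

lemma scheme_lhs_cong:
  assumes "\<And>l. l \<in> {i-2..i+2} \<Longrightarrow> g l = g' l"
  shows "scheme_lhs D dt h M u g i = scheme_lhs D dt h M u g' i"
proof -
  have "g (i-2) = g' (i-2)" "g (i-1) = g' (i-1)" "g i = g' i"
    "g (i+1) = g' (i+1)" "g (i+2) = g' (i+2)"
    by (simp_all add: assms)
  then show ?thesis by (simp only: scheme_lhs_def)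
qed

lemma scheme_lhs_sum:
  "scheme_lhs D dt h M u (\<lambda>i. \<Sum>j\<in>J. c j * f j i) i = (\<Sum>j\<in>J. c j * scheme_lhs D dt h M u (f j) i)"
proof (cases "finite J")
  case True
  have zero: "scheme_lhs D dt h M u (\<lambda>i. 0) i = 0"
    by (simp add: scheme_lhs_def)
  have lin: "scheme_lhs D dt h M u (\<lambda>i. a * p i + q i) i
      = a * scheme_lhs D dt h M u p i + scheme_lhs D dt h M u q i" for a p q
    unfolding scheme_lhs_def
    by (cases "odd i") (simp_all add: add_divide_distrib diff_divide_distrib algebra_simps)
  show ?thesis using True
    by induction (simp_all add: zero lin)
qed (simp add: scheme_lhs_def)

text \<open>For the unknown vector \<open>g\<close>, the scheme is the linear system with matrix \<^const>\<open>coeff_mat\<close>.\<close>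

lemma scheme_iff_coeff_mat:
  assumes N: "N \<ge> 3" and g: "g \<in> carrier_vec N" and b: "b \<in> carrier_vec N"
  shows "(\<forall>i \<in> {1..int N}. scheme_lhs D dt h M u
             (ghost_even (int N) (\<lambda>j. g $ nat (j - 1))) i = M i * b $ nat (i - 1))
         \<longleftrightarrow> coeff_mat N D dt h M u *\<^sub>v g = vec N (\<lambda>i. M (int i + 1) * b $ i)"
proof -
  let ?e = "\<lambda>j::nat. ghost_even (int N) (\<lambda>l. if l = int j + 1 then 1 else 0)"
  let ?g = "ghost_even (int N) (\<lambda>j. g $ nat (j - 1))"
  have ext: "?g l = (\<Sum>j<N. g $ j * ?e j l)" if "l \<in> {-1..int N + 2}" for l
  proof -
    have r: "reflect (int N) l \<in> {1..int N}"
      using that N by (auto simp: reflect_def)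
    have "(\<Sum>j<N. g $ j * ?e j l) = (\<Sum>j<N. if j = nat (reflect (int N) l - 1) then g $ j else 0)"
      using r by (intro sum.cong) (auto simp: ghost_even_def)
    also have "\<dots> = g $ nat (reflect (int N) l - 1)"
      using r by (subst sum.delta) auto
    finally show ?thesis by (simp add: ghost_even_def)
  qed
  have row: "(coeff_mat N D dt h M u *\<^sub>v g) $ i = scheme_lhs D dt h M u ?g (int i + 1)"
    if i: "i < N" for i
  proof -
    have "(coeff_mat N D dt h M u *\<^sub>v g) $ i
        = (\<Sum>j<N. g $ j * scheme_lhs D dt h M u (?e j) (int i + 1))"
      using i g by (auto simp: coeff_mat_def scalar_prod_def atLeast0LessThan mult.commute
          intro!: sum.cong)
    also have "\<dots> = scheme_lhs D dt h M u (\<lambda>l. \<Sum>j<N. g $ j * ?e j l) (int i + 1)"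
      by (simp only: scheme_lhs_sum)
    also have "\<dots> = scheme_lhs D dt h M u ?g (int i + 1)"
      using i by (intro scheme_lhs_cong ext[symmetric]) auto
    finally show ?thesis .
  qed
  show ?thesis
  proof
    assume L: "\<forall>i \<in> {1..int N}. scheme_lhs D dt h M u ?g i = M i * b $ nat (i - 1)"
    show "coeff_mat N D dt h M u *\<^sub>v g = vec N (\<lambda>i. M (int i + 1) * b $ i)"
    proof (rule eq_vecI)
      fix i assume "i < dim_vec (vec N (\<lambda>i. M (int i + 1) * b $ i))"
      then have i: "i < N" by simp
      with L have "scheme_lhs D dt h M u ?g (int i + 1) = M (int i + 1) * b $ i" by force
      then show "(coeff_mat N D dt h M u *\<^sub>v g) $ i = vec N (\<lambda>i. M (int i + 1) * b $ i) $ i"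
        using row[OF i] i by simp
    qed (simp add: coeff_mat_def)
  next
    assume R: "coeff_mat N D dt h M u *\<^sub>v g = vec N (\<lambda>i. M (int i + 1) * b $ i)"
    show "\<forall>i \<in> {1..int N}. scheme_lhs D dt h M u ?g i = M i * b $ nat (i - 1)"
    proof
      fix i assume i: "i \<in> {1..int N}"
      then have "nat (i - 1) < N" "int (nat (i - 1)) + 1 = i" by auto
      then show "scheme_lhs D dt h M u ?g i = M i * b $ nat (i - 1)"
        using row[of "nat (i - 1)"] R by simp
    qed
  qed
qed

end

theory Submission
  imports Defs
begin

text \<open>Let \<open>A\<^sup>z\<close> consist of the entries of \<open>A\<close> from odd to even points, all of which are nonpositive.
  Since every path in \<open>A\<^sup>z\<close> has length at most one, \<open>A\<^sub>d + A\<^sup>z\<close> is triangular up to a permutation and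
  hence an M-matrix without any restriction on the size of its entries. The only entries which may be
  positive connect neighbouring odd points, and they are dominated by \<open>A\<^sup>z A\<^sub>d\<^sup>-\<^sup>1 A\<^sup>s\<close>: this is an
  inequality in the values on a single cell. For the factorization put \<open>Z = A\<^sup>z A\<^sub>d\<^sup>-\<^sup>1\<close>. Then
  \<open>Z\<^sup>2 = 0\<close> and \<open>A = (I + Z) ((I - Z) A)\<close>, where \<open>(I - Z) A\<close> has nonpositive off-diagonal entries by the
  domination, and positive row sums because \<open>A\<close> has. A divergence free velocity vanishes
  identically, by the boundary condition, so the last claim is a special case.\<close>

section \<open>Z-matrices with a positive weight vector\<close>

lemma index_mult_mat_sum:
  assumes "A \<in> carrier_mat n m" "B \<in> carrier_mat m p" "i < n" "j < p"
  shows "(A * B) $$ (i, j) = (\<Sum>l<m. A $$ (i, l) * B $$ (l, j))"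
  using assms by (simp add: scalar_prod_def atLeast0LessThan)

text \<open>With \<open>s\<close> the largest diagonal entry, \<open>B = s I - A\<close> is
  nonnegative and the weights give \<open>B w < s w\<close>. So \<open>B\<close> has norm below
  \<open>s\<close> in the maximum norm scaled by \<open>w\<close>, and that norm bounds every
  eigenvalue.\<close>

lemma nonsing_M_matrix_pos_weights:
  fixes w :: "nat \<Rightarrow> real"
  assumes A: "A \<in> carrier_mat n n" and n: "n > 0"
    and off: "\<And>i j. i < n \<Longrightarrow> j < n \<Longrightarrow> i \<noteq> j \<Longrightarrow> A $$ (i, j) \<le> 0"
    and w: "\<And>i. i < n \<Longrightarrow> w i > 0"
    and Aw: "\<And>i. i < n \<Longrightarrow> (\<Sum>j<n. A $$ (i, j) * w j) > 0"
  shows "nonsing_M_matrix A"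
proof -
  define s where "s = Max ((\<lambda>i. A $$ (i, i)) ` {..<n})"
  have s: "A $$ (i, i) \<le> s" if "i < n" for i
    unfolding s_def using that by (intro Max_ge) auto
  define B where "B = s \<cdot>\<^sub>m 1\<^sub>m n - A"
  have B: "B \<in> carrier_mat n n" using A unfolding B_def by auto
  have Bij: "B $$ (i, j) = (if i = j then s else 0) - A $$ (i, j)" if "i < n" "j < n" for i j
    using that A by (simp add: B_def)
  have B0: "B $$ (i, j) \<ge> 0" if "i < n" "j < n" for i j
    using that s[of i] off[of i j] by (auto simp: Bij)
  have Bw: "(\<Sum>j<n. B $$ (i, j) * w j) < s * w i" if i: "i < n" for i
  proof -
    have "(\<Sum>j<n. B $$ (i, j) * w j)
        = (\<Sum>j<n. (if i = j then s * w j else 0) - A $$ (i, j) * w j)"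
      using i by (intro sum.cong) (auto simp: Bij algebra_simps)
    also have "\<dots> = s * w i - (\<Sum>j<n. A $$ (i, j) * w j)"
      using i by (simp add: sum_subtractf)
    finally show ?thesis using Aw[OF i] by simp
  qed
  let ?C = "map_mat complex_of_real B"
  have C: "?C \<in> carrier_mat n n" using B by simp
  have "spectral_radius ?C \<in> norm ` spectrum ?C"
    by (rule spectral_radius_mem_max(1)[OF C n])
  then obtain ev where ev: "ev \<in> spectrum ?C" "spectral_radius ?C = norm ev" by auto
  then obtain v where v: "v \<in> carrier_vec n" "v \<noteq> 0\<^sub>v n" "?C *\<^sub>v v = ev \<cdot>\<^sub>v v"
    using B by (auto simp: spectrum_def eigenvalue_def eigenvector_def)
  \<comment> \<open>At an index where this ratio is largest, the row of the eigenvalue equation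
    gives \<open>norm ev < s\<close>. The maximum is positive because \<open>v\<close> is
    nonzero.\<close>
  define q where "q i = norm (v $ i) / w i" for i
  have "\<exists>i\<in>{..<n}. \<forall>j\<in>{..<n}. q j \<le> q i"
  proof -
    have "Max (q ` {..<n}) \<in> q ` {..<n}" using n by (intro Max_in) auto
    then obtain i where "i < n" "Max (q ` {..<n}) = q i" by auto
    then show ?thesis by (metis Max_ge finite_imageI finite_lessThan imageI lessThan_iff)
  qed
  then obtain i where i: "i < n" and qi: "\<And>j. j < n \<Longrightarrow> q j \<le> q i" by auto
  have vj: "norm (v $ j) \<le> q i * w j" if "j < n" for j
    using qi[OF that] w[OF that] by (simp add: q_def pos_divide_le_eq)
  have "\<exists>j<n. v $ j \<noteq> 0"
    using v(1,2) by (metis carrier_vecD eq_vecI index_zero_vec(1) index_zero_vec(2))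
  then obtain j where j: "j < n" "v $ j \<noteq> 0" by blast
  then have "0 < q j" using w by (simp add: q_def)
  then have qpos: "q i > 0" using qi[OF j(1)] by simp
  have vi: "norm (v $ i) = q i * w i" using w[OF i] by (simp add: q_def)
  have "ev * v $ i = (\<Sum>j<n. of_real (B $$ (i, j)) * v $ j)"
  proof -
    have "ev * v $ i = (?C *\<^sub>v v) $ i" using v i by simp
    also have "\<dots> = (\<Sum>j<n. of_real (B $$ (i, j)) * v $ j)"
      using i v(1) B by (simp add: scalar_prod_def atLeast0LessThan)
    finally show ?thesis .
  qed
  then have "norm ev * (q i * w i) = norm (\<Sum>j<n. of_real (B $$ (i, j)) * v $ j)"
    by (metis norm_mult vi)
  also have "\<dots> \<le> (\<Sum>j<n. B $$ (i, j) * (q i * w j))"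
    using B0[OF i] vj by (intro sum_norm_le) (auto simp: norm_mult intro!: mult_left_mono)
  also have "\<dots> = q i * (\<Sum>j<n. B $$ (i, j) * w j)"
    by (simp add: sum_distrib_left algebra_simps)
  also have "\<dots> < q i * (s * w i)"
    using Bw[OF i] qpos by simp
  finally have "norm ev < s"
    using qpos w[OF i] by (simp add: mult.left_commute)
  moreover have "A = s \<cdot>\<^sub>m 1\<^sub>m n - B"
    using A by (intro eq_matI) (auto simp: B_def)
  moreover have "0\<^sub>m n n \<le> B"
    using B B0 by (auto simp: less_eq_mat_def)
  ultimately show ?thesis
    using A B ev(2) unfolding nonsing_M_matrix_def square_mat.simps by fastforce
qed

text \<open>A minimum principle: if \<open>A v >= 0\<close> and the least ratio
  \<open>v j / w j\<close> were negative, the row attaining it would be at most that ratio times its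
  positive weighted row sum. Applied to \<open>v\<close> and \<open>- v\<close> it yields
  invertibility; applied to the columns of the inverse it yields their sign.\<close>

lemma monotone_mat_pos_weights:
  fixes w :: "nat \<Rightarrow> real"
  assumes A: "A \<in> carrier_mat n n"
    and off: "\<And>i j. i < n \<Longrightarrow> j < n \<Longrightarrow> i \<noteq> j \<Longrightarrow> A $$ (i, j) \<le> 0"
    and w: "\<And>i. i < n \<Longrightarrow> w i > 0"
    and Aw: "\<And>i. i < n \<Longrightarrow> (\<Sum>j<n. A $$ (i, j) * w j) > 0"
  shows "monotone_mat A"
proof -
  have mp: "v $ i \<ge> 0"
    if v: "v \<in> carrier_vec n" and Av: "\<And>i. i < n \<Longrightarrow> (A *\<^sub>v v) $ i \<ge> 0" and i: "i < n" for v i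
  proof (rule ccontr)
    assume neg: "\<not> v $ i \<ge> 0"
    define q where "q j = v $ j / w j" for j
    have "Min (q ` {..<n}) \<in> q ` {..<n}" using i by (intro Min_in) auto
    then obtain l where l: "l < n" and ql: "Min (q ` {..<n}) = q l" by auto
    have q: "q l \<le> q j" if "j < n" for j
      unfolding ql[symmetric] using that by (intro Min_le) auto
    have "q i < 0" using neg w[OF i] by (simp add: q_def divide_neg_pos)
    then have q0: "q l < 0" using q[OF i] by simp
    have "(A *\<^sub>v v) $ l = (\<Sum>j<n. A $$ (l, j) * v $ j)"
      using l v A by (simp add: scalar_prod_def atLeast0LessThan)
    also have "\<dots> \<le> (\<Sum>j<n. A $$ (l, j) * (q l * w j))"
    proof (intro sum_mono)
      fix j assume "j \<in> {..<n}"
      then have j: "j < n" by simp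
      show "A $$ (l, j) * v $ j \<le> A $$ (l, j) * (q l * w j)"
      proof (cases "j = l")
        case True
        then show ?thesis using w[OF l] by (simp add: q_def)
      next
        case False
        have "q l * w j \<le> v $ j" using q[OF j] w[OF j] by (simp add: q_def pos_le_divide_eq)
        then show ?thesis using off[OF l j] False by (intro mult_left_mono_neg) auto
      qed
    qed
    also have "\<dots> = q l * (\<Sum>j<n. A $$ (l, j) * w j)"
      by (simp add: sum_distrib_left algebra_simps)
    also have "\<dots> < 0" using q0 Aw[OF l] by (rule mult_neg_pos)
    finally show False using Av[OF l] by simp
  qed
  have "v = 0\<^sub>v n" if v: "v \<in> carrier_vec n" and 0: "A *\<^sub>v v = 0\<^sub>v n" for v
  proof (rule eq_vecI)
    fix i assume "i < dim_vec (0\<^sub>v n :: real vec)"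
    then have i: "i < n" by simp
    have "v $ i \<ge> 0" by (rule mp[OF v _ i]) (simp add: 0)
    moreover have "(- v) $ i \<ge> 0"
    proof (rule mp[OF _ _ i])
      show "- v \<in> carrier_vec n" using v by simp
      fix j assume j: "j < n"
      have "(A *\<^sub>v (- v)) = - (A *\<^sub>v v)" using A v by auto
      then show "(A *\<^sub>v (- v)) $ j \<ge> 0" using j by (simp add: 0)
    qed
    ultimately show "v $ i = 0\<^sub>v n $ i" using i v by simp
  qed (use v in simp)
  then have "det A \<noteq> 0" using det_0_iff_vec_prod_zero_field[OF A] by blast
  from det_non_zero_imp_unit[OF A this, of "()"]
  obtain B where B: "B \<in> carrier_mat n n" "B * A = 1\<^sub>m n" "A * B = 1\<^sub>m n"
    by (auto simp: Units_def ring_mat_def)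
  have "B $$ (i, j) \<ge> 0" if i: "i < n" and j: "j < n" for i j
  proof -
    have "A *\<^sub>v col B j = unit_vec n j"
      using A B j by (metis col_mult2 col_one)
    then have "col B j $ i \<ge> 0"
      using B(1) j by (intro mp[OF _ _ i]) (auto simp: unit_vec_def)
    then show ?thesis using B(1) i j by simp
  qed
  then have "0\<^sub>m n n \<le> B" using B(1) by (auto simp: less_eq_mat_def)
  then show ?thesis
    using A B by (auto simp: monotone_mat_def inverts_mat_def)
qed

lemma monotone_mat_mult:
  assumes A: "A \<in> carrier_mat n n" "monotone_mat A" and B: "B \<in> carrier_mat n n" "monotone_mat B"
  shows "monotone_mat (A * B)"
proof -
  obtain A' where A': "A' \<in> carrier_mat n n" "A * A' = 1\<^sub>m n" "A' * A = 1\<^sub>m n" "0\<^sub>m n n \<le> A'"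
    using A by (auto simp: monotone_mat_def inverts_mat_def)
  obtain B' where B': "B' \<in> carrier_mat n n" "B * B' = 1\<^sub>m n" "B' * B = 1\<^sub>m n" "0\<^sub>m n n \<le> B'"
    using B by (auto simp: monotone_mat_def inverts_mat_def)
  have cancel: "(P * Q) * (Q' * P') = 1\<^sub>m n"
    if "P \<in> carrier_mat n n" "P' \<in> carrier_mat n n" "Q \<in> carrier_mat n n" "Q' \<in> carrier_mat n n"
      "Q * Q' = 1\<^sub>m n" "P * P' = 1\<^sub>m n" for P P' Q Q' :: "real mat"
  proof -
    have "(P * Q) * (Q' * P') = P * (Q * (Q' * P'))"
      using that by (simp add: assoc_mult_mat[of _ n n _ n _ n])
    also have "Q * (Q' * P') = (Q * Q') * P'"
      using that(2-4) by (simp add: assoc_mult_mat[of _ n n _ n _ n])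
    finally show ?thesis using that by simp
  qed
  have "0\<^sub>m n n \<le> B' * A'"
    using A' B' by (auto simp: less_eq_mat_def scalar_prod_def intro!: sum_nonneg)
  then show ?thesis
    using A(1) A' B(1) B' cancel[of A A' B B'] cancel[of B' B A' A]
    unfolding monotone_mat_def inverts_mat_def
    by (intro conjI bexI[of _ "B' * A'"]) auto
qed

section \<open>Lorenz's conditions on a two-coloured index set\<close>

text \<open>Rows outside \<open>P\<close> are diagonal, so the weight there can be 1. Off-diagonal
  entries of rows in \<open>P\<close> meet only such columns, so the weights on \<open>P\<close> can
  be chosen afterwards, one row at a time.\<close>

lemma two_colour_weights:
  assumes diag: "\<And>i. i < n \<Longrightarrow> C $$ (i, i) > (0::real)"
    and zero: "\<And>i j. i < n \<Longrightarrow> j < n \<Longrightarrow> i \<noteq> j \<Longrightarrow> \<not> (P i \<and> \<not> P j) \<Longrightarrow> C $$ (i, j) = 0"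
  obtains w :: "nat \<Rightarrow> real"
  where "\<And>i. i < n \<Longrightarrow> w i > 0" "\<And>i. i < n \<Longrightarrow> (\<Sum>j<n. C $$ (i, j) * w j) > 0"
proof
  define r where "r i = (\<Sum>j\<in>{..<n} - {i}. \<bar>C $$ (i, j)\<bar>)" for i
  have r: "r i \<ge> 0" for i unfolding r_def by (rule sum_nonneg) simp
  \<comment> \<open>On \<open>P\<close> the diagonal term becomes \<open>1 + r i\<close>, which
    exceeds the absolute sum of the rest of the row by 1.\<close>
  define w where "w i = (if P i then (1 + r i) / C $$ (i, i) else 1)" for i
  show w: "w i > 0" if "i < n" for i
    using diag[OF that] r[of i] by (auto simp: w_def intro!: divide_pos_pos add_pos_nonneg)
  fix i assume i: "i < n"
  have split: "(\<Sum>j<n. C $$ (i, j) * w j)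
      = C $$ (i, i) * w i + (\<Sum>j\<in>{..<n} - {i}. C $$ (i, j) * w j)"
    using i by (subst sum.remove[of _ i]) auto
  show "(\<Sum>j<n. C $$ (i, j) * w j) > 0"
  proof (cases "P i")
    case True
    have "(\<Sum>j\<in>{..<n} - {i}. - \<bar>C $$ (i, j)\<bar>) \<le> (\<Sum>j\<in>{..<n} - {i}. C $$ (i, j) * w j)"
    proof (rule sum_mono)
      fix j assume "j \<in> {..<n} - {i}"
      then have "C $$ (i, j) = 0 \<or> w j = 1"
        using zero[of i j] i True by (auto simp: w_def)
      then show "- \<bar>C $$ (i, j)\<bar> \<le> C $$ (i, j) * w j" by auto
    qed
    then have "(\<Sum>j\<in>{..<n} - {i}. C $$ (i, j) * w j) \<ge> - r i"
      by (simp add: r_def sum_negf)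
    moreover have "C $$ (i, i) * w i = 1 + r i"
      using diag[OF i] True by (simp add: w_def)
    ultimately show ?thesis unfolding split by linarith
  next
    case False
    then have "(\<Sum>j\<in>{..<n} - {i}. C $$ (i, j) * w j) = 0"
      using zero i by (intro sum.neutral) auto
    then show ?thesis using split diag[OF i] w[OF i] by simp
  qed
qed

text \<open>In the scheme, \<open>P\<close> marks the rows of odd grid points; matrix indices start at 0, so these are
  the even indices.\<close>

locale two_colour =
  fixes A :: "real mat" and n :: nat and P :: "nat \<Rightarrow> bool"
  assumes A: "A \<in> carrier_mat n n" and n: "n > 0"
    and diag: "i < n \<Longrightarrow> A $$ (i, i) > 0"
    and PQ: "\<lbrakk>i < n; j < n; P i; \<not> P j\<rbrakk> \<Longrightarrow> A $$ (i, j) \<le> 0"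
    and Q: "\<lbrakk>i < n; j < n; \<not> P i; i \<noteq> j\<rbrakk> \<Longrightarrow> A $$ (i, j) \<le> 0"
    and PP: "\<lbrakk>i < n; j < n; P i; P j; i \<noteq> j\<rbrakk> \<Longrightarrow>
      A $$ (i, j) \<le> (\<Sum>l | l < n \<and> \<not> P l. A $$ (i, l) * A $$ (l, j) / A $$ (l, l))"
    and row_sum: "i < n \<Longrightarrow> (\<Sum>j<n. A $$ (i, j)) > 0"
begin

text \<open>For condition (2), a positive off-diagonal entry can only join two indices in
  \<open>P\<close>, where \<open>PP\<close> is the required bound. For condition (3), all row sums
  are positive, so with the vector of ones the set \<open>N0\<close> is empty and nothing has to be
  connected.\<close>

lemma lorenz: "lorenz_conditions A"
proof -
  define Az where "Az = mat n n (\<lambda>(i, j). if P i \<and> \<not> P j then A $$ (i, j) else 0)"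
  define As where "As = neg_offdiag A - Az"
  define Di where "Di = mat n n (\<lambda>(i, j). if i = j then 1 / A $$ (i, i) else 0)"
  have dims: "dim_row A = n" "dim_col A = n" using A by auto
  have carrier: "Az \<in> carrier_mat n n" "As \<in> carrier_mat n n" "Di \<in> carrier_mat n n"
    "diag_part A \<in> carrier_mat n n" "neg_offdiag A \<in> carrier_mat n n"
    by (auto simp: Az_def As_def Di_def diag_part_def neg_offdiag_def pos_offdiag_def dims)
  have Az: "Az $$ (i, j) = (if P i \<and> \<not> P j then A $$ (i, j) else 0)" if "i < n" "j < n" for i j
    using that by (simp add: Az_def)
  have neg: "neg_offdiag A $$ (i, j) = (if i \<noteq> j then min 0 (A $$ (i, j)) else 0)"
    if "i < n" "j < n" for i j
    using that by (auto simp: neg_offdiag_def diag_part_def pos_offdiag_def dims)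
  have As: "As $$ (i, j) = neg_offdiag A $$ (i, j) - Az $$ (i, j)" if "i < n" "j < n" for i j
    using that carrier by (simp add: As_def)
  have Az0: "Az $$ (i, j) \<le> 0" and As0: "As $$ (i, j) \<le> 0" if "i < n" "j < n" for i j
    using that PQ[of i j] by (auto simp: Az As neg)
  have prod: "(Az * Di * As) $$ (i, j) = (\<Sum>l<n. Az $$ (i, l) / A $$ (l, l) * As $$ (l, j))"
    if i: "i < n" and j: "j < n" for i j
  proof -
    have "(Az * Di) $$ (i, l) = Az $$ (i, l) / A $$ (l, l)" if l: "l < n" for l
    proof -
      have "(Az * Di) $$ (i, l) = (\<Sum>m<n. Az $$ (i, m) * Di $$ (m, l))"
        using i l carrier by (intro index_mult_mat_sum)
      also have "\<dots> = (\<Sum>m<n. if m = l then Az $$ (i, m) / A $$ (m, m) else 0)"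
        using l by (intro sum.cong) (auto simp: Di_def)
      finally show ?thesis using l by simp
    qed
    then show ?thesis
      using index_mult_mat_sum[OF mult_carrier_mat[OF carrier(1,3)] carrier(2) i j] by simp
  qed
  have M: "nonsing_M_matrix (diag_part A + Az)"
  proof -
    let ?C = "diag_part A + Az"
    have C: "?C $$ (i, j) = (if i = j then A $$ (i, i) else Az $$ (i, j))"
      if "i < n" "j < n" for i j
      using that carrier by (auto simp: diag_part_def dims Az)
    obtain w where "\<And>i. i < n \<Longrightarrow> w i > 0" "\<And>i. i < n \<Longrightarrow> (\<Sum>j<n. ?C $$ (i, j) * w j) > 0"
      by (rule two_colour_weights[of n ?C P]) (auto simp: C diag Az)
    then show ?thesis
      using carrier n Az0 C by (intro nonsing_M_matrix_pos_weights[where w = w and n = n]) auto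
  qed
  have inv: "inverts_mat (diag_part A) Di" "inverts_mat Di (diag_part A)"
  proof -
    have *: "(\<Sum>l<n. (if i = l then f l else 0) * (if l = j then g l else 0)) = (if i = j then 1 else 0)"
      if "i < n" "f i * g i = (1::real)" for i j and f g :: "nat \<Rightarrow> real"
    proof -
      have "(\<Sum>l<n. (if i = l then f l else 0) * (if l = j then g l else 0))
          = (\<Sum>l<n. if l = i then (if i = j then f i * g i else 0) else 0)"
        by (intro sum.cong) auto
      then show ?thesis using that by (cases "i = j") auto
    qed
    have d: "A $$ (i, i) \<noteq> 0" if "i < n" for i using diag[OF that] by simp
    have "(diag_part A * Di) $$ (i, j) = 1\<^sub>m n $$ (i, j)" if ij: "i < n" "j < n" for i j
    proof -
      have "(diag_part A * Di) $$ (i, j) = (\<Sum>l<n. diag_part A $$ (i, l) * Di $$ (l, j))"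
        using carrier ij by (intro index_mult_mat_sum)
      also have "\<dots> = (\<Sum>l<n. (if i = l then A $$ (l, l) else 0) * (if l = j then 1 / A $$ (l, l) else 0))"
        using ij by (intro sum.cong) (auto simp: Di_def diag_part_def dims)
      also have "\<dots> = 1\<^sub>m n $$ (i, j)" using ij d by (subst *) auto
      finally show ?thesis .
    qed
    then have "diag_part A * Di = 1\<^sub>m n" using carrier by (intro eq_matI) auto
    then show "inverts_mat (diag_part A) Di" "inverts_mat Di (diag_part A)"
      using mat_mult_left_right_inverse[of "diag_part A" n Di] carrier by (auto simp: inverts_mat_def)
  qed
  have pos: "pos_offdiag A \<le> Az * Di * As"
    unfolding less_eq_mat_def
  proof (intro conjI allI impI)
    fix i j assume "i < dim_row (Az * Di * As)" "j < dim_col (Az * Di * As)"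
    then have i: "i < n" and j: "j < n" using carrier by auto
    show "pos_offdiag A $$ (i, j) \<le> (Az * Di * As) $$ (i, j)"
    proof (cases "i \<noteq> j \<and> A $$ (i, j) > 0")
      case True
      then have ij: "P i" "P j" using PQ[OF i j] Q[OF i j] by force+
      have "A $$ (i, j) \<le> (\<Sum>l | l < n \<and> \<not> P l. A $$ (i, l) * A $$ (l, j) / A $$ (l, l))"
        using PP[OF i j ij] True by simp
      also have "\<dots> = (\<Sum>l | l < n \<and> \<not> P l. Az $$ (i, l) / A $$ (l, l) * As $$ (l, j))"
      proof (intro sum.cong refl)
        \<comment> \<open>Column \<open>j\<close> is in \<open>P\<close> and row \<open>l\<close> is
          not, so the entry at \<open>(l, j)\<close> is nonpositive, off the diagonal and outside
          \<open>Az\<close>; hence \<open>As\<close> carries it in full.\<close>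
        fix l assume "l \<in> {l. l < n \<and> \<not> P l}"
        then have l: "l < n" "\<not> P l" by auto
        then have "l \<noteq> j" using ij by auto
        then have "l \<noteq> j" "min 0 (A $$ (l, j)) = A $$ (l, j)" using Q[OF l(1) j l(2)] by auto
        then show "A $$ (i, l) * A $$ (l, j) / A $$ (l, l) = Az $$ (i, l) / A $$ (l, l) * As $$ (l, j)"
          using i j l ij by (simp add: Az As neg)
      qed
      also have "\<dots> = (\<Sum>l<n. Az $$ (i, l) / A $$ (l, l) * As $$ (l, j))"
        using i by (intro sum.mono_neutral_left) (auto simp: Az)
      finally show ?thesis using True i j by (simp add: prod pos_offdiag_def dims)
    next
      case False
      have "0 \<le> (\<Sum>l<n. Az $$ (i, l) / A $$ (l, l) * As $$ (l, j))"
        using i j Az0 As0 diag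
        by (intro sum_nonneg mult_nonpos_nonpos) (auto simp: divide_nonpos_pos)
      then show ?thesis using False i j by (auto simp: prod pos_offdiag_def dims)
    qed
  qed (use carrier in \<open>auto simp: pos_offdiag_def dims\<close>)
  define e :: "real vec" where "e = vec n (\<lambda>_. 1)"
  have Ae: "(A *\<^sub>v e) $ i > 0" if "i < n" for i
    using row_sum[OF that] that A by (simp add: e_def scalar_prod_def atLeast0LessThan)
  have e: "e \<in> carrier_vec n" "e \<noteq> 0\<^sub>v n" "0\<^sub>v n \<le> e" "0\<^sub>v n \<le> A *\<^sub>v e"
    using n A Ae by (auto simp: e_def less_eq_vec_def less_imp_le dest!: arg_cong[where f = "\<lambda>v. v $ 0"])
  have "{i. i < n \<and> (A *\<^sub>v e) $ i = 0} = {}" using Ae by force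
  then have conn: "connects Az {i. i < n \<and> (A *\<^sub>v e) $ i = 0} {i. i < n \<and> (A *\<^sub>v e) $ i > 0}"
    unfolding connects_def by blast
  have sum: "neg_offdiag A = Az + As" using carrier by (intro eq_matI) (auto simp: As)
  have le: "Az \<le> 0\<^sub>m n n" "As \<le> 0\<^sub>m n n"
    using carrier Az0 As0 by (auto simp: less_eq_mat_def)
  have ex: "\<exists>Ad_inv\<in>carrier_mat n n. inverts_mat (diag_part A) Ad_inv \<and>
      inverts_mat Ad_inv (diag_part A) \<and> pos_offdiag A \<le> Az * Ad_inv * As"
    using inv pos carrier(3) by blast
  have eex: "\<exists>e\<in>carrier_vec n. e \<noteq> 0\<^sub>v n \<and> 0\<^sub>v n \<le> e \<and> 0\<^sub>v n \<le> A *\<^sub>v e \<and>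
      (connects Az {i. i < n \<and> (A *\<^sub>v e) $ i = 0} {i. i < n \<and> (A *\<^sub>v e) $ i > 0} \<or>
       connects As {i. i < n \<and> (A *\<^sub>v e) $ i = 0} {i. i < n \<and> (A *\<^sub>v e) $ i > 0})"
    using e conn by blast
  show ?thesis
    unfolding lorenz_conditions_def Let_def dims
    by (rule conjI, simp add: dims, rule bexI[of _ Az], rule bexI[of _ As], intro conjI sum le M ex eex)
      (use carrier in auto)
qed

text \<open>\<open>M1 = I + Z\<close> has the two-colour shape, which supplies its weights, while
  \<open>M2 = (I - Z) A\<close> takes all weights equal to 1. The same weights serve for M-matrix
  and for monotone.\<close>

lemma product_M_matrices:
  obtains M1 M2 where "M1 \<in> carrier_mat n n" "M2 \<in> carrier_mat n n"
    "nonsing_M_matrix M1" "nonsing_M_matrix M2" "A = M1 * M2"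
    "monotone_mat M1" "monotone_mat M2"
proof -
  define Z where "Z = mat n n (\<lambda>(i, j). if P i \<and> \<not> P j then A $$ (i, j) / A $$ (j, j) else 0)"
  have Z: "Z \<in> carrier_mat n n" by (simp add: Z_def)
  have Zij: "Z $$ (i, j) = (if P i \<and> \<not> P j then A $$ (i, j) / A $$ (j, j) else 0)"
    if "i < n" "j < n" for i j using that by (simp add: Z_def)
  have Z0: "Z $$ (i, j) \<le> 0" if "i < n" "j < n" for i j
    using that PQ[of i j] diag[of j] by (auto simp: Zij divide_nonpos_pos)
  define M1 where "M1 = 1\<^sub>m n + Z"
  define M2 where "M2 = A - Z * A"
  have M1: "M1 \<in> carrier_mat n n" and M2: "M2 \<in> carrier_mat n n"
    using A Z by (auto simp: M1_def M2_def)
  have M1ij: "M1 $$ (i, j) = (if i = j then 1 else Z $$ (i, j))" if "i < n" "j < n" for i j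
    using that Z by (auto simp: M1_def Zij)
  obtain w where w: "\<And>i. i < n \<Longrightarrow> w i > 0" "\<And>i. i < n \<Longrightarrow> (\<Sum>j<n. M1 $$ (i, j) * w j) > 0"
    by (rule two_colour_weights[of n M1 P]) (auto simp: M1ij Zij)
  have M1off: "M1 $$ (i, j) \<le> 0" if "i < n" "j < n" "i \<noteq> j" for i j
    using that Z0 by (simp add: M1ij)
  have M2ij: "M2 $$ (i, j) = A $$ (i, j) - (\<Sum>l<n. Z $$ (i, l) * A $$ (l, j))"
    if "i < n" "j < n" for i j
    using that A Z by (simp add: M2_def scalar_prod_def atLeast0LessThan)
  have ZA: "(\<Sum>l<n. Z $$ (i, l) * A $$ (l, j))
      = (if P i then \<Sum>l | l < n \<and> \<not> P l. A $$ (i, l) * A $$ (l, j) / A $$ (l, l) else 0)"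
    if i: "i < n" for i j
  proof (cases "P i")
    case True
    have "(\<Sum>l<n. Z $$ (i, l) * A $$ (l, j)) = (\<Sum>l | l < n \<and> \<not> P l. Z $$ (i, l) * A $$ (l, j))"
      using i by (intro sum.mono_neutral_right) (auto simp: Zij)
    also have "\<dots> = (\<Sum>l | l < n \<and> \<not> P l. A $$ (i, l) * A $$ (l, j) / A $$ (l, l))"
      using i True by (intro sum.cong) (auto simp: Zij)
    finally show ?thesis using True by simp
  qed (use i in \<open>auto simp: Zij\<close>)
  have M2off: "M2 $$ (i, j) \<le> 0" if i: "i < n" and j: "j < n" and ij: "i \<noteq> j" for i j
  proof -
    consider "\<not> P i" | "P i" "P j" | "P i" "\<not> P j" by blast
    then show ?thesis
    proof cases
      \<comment> \<open>The term \<open>l = j\<close> of the sum is \<open>A $$ (i, j)\<close>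
        itself and cancels it in \<open>M2\<close>; the other terms are nonnegative, being products
        of two nonpositive entries over a positive one.\<close>
      case 3
      let ?f = "\<lambda>l. A $$ (i, l) * A $$ (l, j) / A $$ (l, l)"
      have "?f j = (\<Sum>l\<in>{j}. ?f l)" by simp
      also have "\<dots> \<le> (\<Sum>l | l < n \<and> \<not> P l. ?f l)"
        using 3 j PQ[OF i] Q[OF _ j] diag
        by (intro sum_mono2) (auto intro!: divide_nonneg_pos mult_nonpos_nonpos)
      finally show ?thesis using 3 i j diag[OF j] by (simp add: M2ij ZA)
    qed (use i j ij Q[OF i j] PP[OF i j] in \<open>auto simp: M2ij ZA\<close>)
  qed
  \<comment> \<open>Since \<open>Z <= 0\<close> and \<open>A\<close> has positive row sums,
    subtracting \<open>Z A\<close> cannot lower a row sum.\<close>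
  have M2row: "(\<Sum>j<n. M2 $$ (i, j) * 1) > 0" if i: "i < n" for i
  proof -
    have "(\<Sum>j<n. \<Sum>l<n. Z $$ (i, l) * A $$ (l, j)) = (\<Sum>l<n. Z $$ (i, l) * (\<Sum>j<n. A $$ (l, j)))"
      by (subst sum.swap) (simp add: sum_distrib_left)
    also have "\<dots> \<le> 0"
      using Z0[OF i] row_sum by (intro sum_nonpos) (auto simp: mult_nonpos_nonneg less_imp_le)
    finally show ?thesis using i row_sum[OF i] by (simp add: M2ij sum_subtractf)
  qed
  have "A = M1 * M2"
  proof -
    \<comment> \<open>A nonzero term of \<open>Z * Z\<close> would need a middle index both outside
      and inside \<open>P\<close>.\<close>
    have ZZ: "Z * Z = 0\<^sub>m n n"
      using Z by (intro eq_matI) (auto simp: scalar_prod_def Zij intro!: sum.neutral)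
    have ZZA: "Z * (Z * A) = 0\<^sub>m n n"
      using A Z ZZ assoc_mult_mat[of Z n n Z n A n] by simp
    have "M1 * M2 = M2 + Z * M2"
      using M2 Z by (simp add: M1_def add_mult_distrib_mat[of _ n n])
    also have "Z * M2 = Z * A - 0\<^sub>m n n"
      using A Z ZZA by (simp add: M2_def mult_minus_distrib_mat[of Z n n A n])
    also have "M2 + (Z * A - 0\<^sub>m n n) = A"
      using A Z unfolding M2_def by (intro eq_matI) (auto simp del: index_mult_mat(1))
    finally show ?thesis by simp
  qed
  with M1 M2 show ?thesis
    using n M1off w M2off M2row
    by (intro that[of M1 M2]
        nonsing_M_matrix_pos_weights[of M1 n w] nonsing_M_matrix_pos_weights[of M2 n "\<lambda>_. 1"]
        monotone_mat_pos_weights[of M1 n w] monotone_mat_pos_weights[of M2 n "\<lambda>_. 1"]) auto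
qed

lemma monotone: "monotone_mat A"
  using product_M_matrices monotone_mat_mult by metis

end

section \<open>The coefficient matrix of the scheme\<close>

text \<open>Lorenz's condition on the positive entries, for one cell with \<open>(a, b, c)\<close> the three values of
  the coefficient function, \<open>R = dt D / h\<^sup>2\<close>, and \<open>v, w\<close> the velocities times \<open>h / D\<close>.\<close>

lemma cell_inequality:
  fixes a b c m R v w :: real
  assumes R: "R \<ge> 50" and m: "m > 0" "m \<le> a" "m \<le> b" "m \<le> c"
    and ub: "a \<le> 23/20 * m" "b \<le> 23/20 * m" "c \<le> 23/20 * m"
    and vw: "\<bar>v\<bar> \<le> m / 4" "\<bar>w\<bar> \<le> m / 4"
  shows "R * (- v / 4 + (3 * a - 4 * b + 3 * c) / 8) * (b + R * (a + c))
    \<le> R * (w - (a + 3 * c) / 2) * (R * (v / 2 - (3 * a + c) / 4))"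
proof -
  have v: "- m / 4 \<le> v" "v \<le> m / 4" and w: "- m / 4 \<le> w" "w \<le> m / 4"
    using vw by (auto simp: abs_le_iff)
  \<comment> \<open>The extreme case is \<open>a = c = 23/20 m\<close>, \<open>b = m\<close>,
    \<open>v = - m/4\<close>, with \<open>1/16 + 69/80 - 1/2 = 17/40\<close>.\<close>
  have "- v / 4 + (3 * a - 4 * b + 3 * c) / 8 \<le> 17/40 * m"
    using m ub v by (simp add: field_simps)
  then have *: "R * (- v / 4 + (3 * a - 4 * b + 3 * c) / 8) \<le> R * (17/40 * m)"
    using R by (intro mult_left_mono) auto
  \<comment> \<open>The first factor may be negative; \<open>mult_mono\<close> asks only that its
    upper bound and \<open>b + R * (a + c)\<close> be nonnegative.\<close>
  have "R * (- v / 4 + (3 * a - 4 * b + 3 * c) / 8) * (b + R * (a + c))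
      \<le> R * (17/40 * m) * (R * (2323/1000 * m))"
  proof (rule mult_mono[OF *])
    \<comment> \<open>Here \<open>R >= 50\<close> enters:
      \<open>b <= 23/20 m = 50 * 23/1000 m\<close>, so \<open>b\<close> adds only 23/1000 to the
      23/10 coming from \<open>a + c\<close>.\<close>
    have "0 \<le> 23/1000 * m" using m by simp
    from mult_right_mono[OF R this] have "b \<le> R * (23/1000 * m)"
      using ub(2) by linarith
    moreover have "R * (a + c) \<le> R * (23/10 * m)"
      using ub R by (intro mult_left_mono) auto
    ultimately show "b + R * (a + c) \<le> R * (2323/1000 * m)"
      by (simp add: algebra_simps)
  qed (use R m in auto)
  \<comment> \<open>\<open>17/40 * 2323/1000 < 1\<close>, whereas \<open>7/4 * 7/8 > 3/2\<close>.
    The latter factors come from \<open>(a + 3 c) / 2 >= 2 m\<close> and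
    \<open>(3 a + c) / 4 >= m\<close>, less \<open>m / 4\<close> and \<open>m / 8\<close>.\<close>
  also have "\<dots> \<le> R * (7/4 * m) * (R * (7/8 * m))"
    using R m by (simp add: mult_ac)
  also have "\<dots> \<le> R * ((a + 3 * c) / 2 - w) * (R * ((3 * a + c) / 4 - v / 2))"
  proof (rule mult_mono)
    have "7/4 * m \<le> (a + 3 * c) / 2 - w" using m w by (simp add: field_simps)
    then show "R * (7/4 * m) \<le> R * ((a + 3 * c) / 2 - w)"
      using R by (intro mult_left_mono) auto
    have "7/8 * m \<le> (3 * a + c) / 4 - v / 2" using m v by (simp add: field_simps)
    then show "R * (7/8 * m) \<le> R * ((3 * a + c) / 4 - v / 2)"
      using R by (intro mult_left_mono) auto
    show "0 \<le> R * ((a + 3 * c) / 2 - w)"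
      using R m w by (intro mult_nonneg_nonneg) (auto simp: field_simps)
  qed (use R m in auto)
  also have "\<dots> = R * (w - (a + 3 * c) / 2) * (R * (v / 2 - (3 * a + c) / 4))"
    by (simp add: field_simps)
  finally show ?thesis .
qed

section \<open>Reflection at the ends of the grid\<close>

lemma reflect_id: "1 \<le> i \<Longrightarrow> i \<le> N \<Longrightarrow> reflect N i = i"
  by (simp add: reflect_def)

text \<open>Each reflection is \<open>c - i\<close> with \<open>c\<close> even. Hence substituting
  the ghost values keeps the odd-even colouring of the stencils.\<close>

lemma even_reflect: "even (reflect N i) \<longleftrightarrow> even i"
  by (simp add: reflect_def)

lemma reflect_range: "N \<ge> 3 \<Longrightarrow> - 1 \<le> i \<Longrightarrow> i \<le> N + 2 \<Longrightarrow> 1 \<le> reflect N i \<and> reflect N i \<le> N"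
  by (auto simp: reflect_def)

text \<open>\<open>f\<close> and \<open>v\<close> are the coefficient function and the velocity
  before extension. Maxima, minima and the derivative are replaced by comparisons of two points of
  one cell; \<open>23/20 = 1 + 2 * 0.075\<close>, as such points are at most \<open>2 h\<close>
  apart.\<close>

locale grid_scheme =
  fixes N :: nat and D dt h :: real and f v :: "int \<Rightarrow> real"
  assumes N: "odd N" "N \<ge> 3" and h: "h > 0" and D: "D > 0" and dt: "dt / h\<^sup>2 \<ge> 50 / D"
    and pos: "\<lbrakk>1 \<le> q; q \<le> int N\<rbrakk> \<Longrightarrow> f q > 0"
    and velocity: "\<lbrakk>odd p; 3 \<le> p; p \<le> int N; q \<in> {p-2..p}; s \<in> {p-2..p}\<rbrakk> \<Longrightarrow>
      h * \<bar>v q\<bar> \<le> D / 4 * f s"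
    and ratio: "\<lbrakk>odd p; 3 \<le> p; p \<le> int N; q \<in> {p-2..p}; s \<in> {p-2..p}\<rbrakk> \<Longrightarrow>
      f q \<le> 23/20 * f s"
    and odd_sum: "\<lbrakk>odd p; 1 \<le> p; p \<le> int N\<rbrakk> \<Longrightarrow>
      ghost_even N f p + dt * ((- ghost_odd N v (p-2) + 4 * ghost_odd N v (p-1)
        - 4 * ghost_odd N v (p+1) + ghost_odd N v (p+2)) / (4 * h)) > 0"
    and even_sum: "\<lbrakk>even p; 1 \<le> p; p \<le> int N\<rbrakk> \<Longrightarrow>
      ghost_even N f p + dt * ((ghost_odd N v (p-1) - ghost_odd N v (p+1)) / (2 * h)) > 0"
begin

abbreviation "M \<equiv> ghost_even (int N) f"
abbreviation "U \<equiv> ghost_odd (int N) v"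
abbreviation "r \<equiv> reflect (int N)"

definition "R = dt * D / h\<^sup>2"
definition "w q = h * U q / D"

lemma R: "R \<ge> 50"
  using dt D by (simp add: R_def field_simps)

lemma M_pos: "- 1 \<le> q \<Longrightarrow> q \<le> int N + 2 \<Longrightarrow> M q > 0"
  using N reflect_range[of N q] by (auto simp: ghost_even_def intro!: pos)

text \<open>The odd extension alters the velocity only by a sign, and the bounds on a cell see its
  absolute value, so a ghost point can be replaced by its mirror image.\<close>

lemma ghost_left: "q \<le> 1 \<Longrightarrow> q \<ge> - 1 \<Longrightarrow> M q = f (2 - q) \<and> \<bar>U q\<bar> = \<bar>v (2 - q)\<bar>"
  using N by (cases "q = 1") (auto simp: ghost_even_def ghost_odd_def reflect_def)

lemma ghost_right:
  "q \<ge> int N \<Longrightarrow> q \<le> int N + 2 \<Longrightarrow> M q = f (2 * int N - q) \<and> \<bar>U q\<bar> = \<bar>v (2 * int N - q)\<bar>"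
  using N by (cases "q = int N") (auto simp: ghost_even_def ghost_odd_def reflect_def)

lemma ghost_inside: "1 \<le> q \<Longrightarrow> q \<le> int N \<Longrightarrow> M q = f q \<and> U q = v q"
  by (auto simp: ghost_even_def ghost_odd_def reflect_def)

text \<open>By the reflections, the bounds extend to the ghost cells \<open>{-1, 0, 1}\<close> and \<open>{N, N + 1, N + 2}\<close>, so
  that the boundary rows need no inequality of their own.\<close>

lemma cell:
  assumes "odd p" "1 \<le> p" "p \<le> int N + 2" "q \<in> {p-2..p}" "s \<in> {p-2..p}"
  shows "\<bar>w q\<bar> \<le> M s / 4" "M q \<le> 23/20 * M s"
proof -
  have "h * \<bar>U q\<bar> \<le> D / 4 * M s \<and> M q \<le> 23/20 * M s"
  proof -
    have "p \<noteq> 2" "p \<noteq> int N + 1" using assms(1) N(1) by auto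
    then consider "p = 1" | "3 \<le> p" "p \<le> int N" | "p = int N + 2"
      using assms(2,3) by linarith
    then show ?thesis
    proof cases
      case 1
      then show ?thesis
        using assms N ghost_left[of q] ghost_left[of s]
          velocity[of 3 "2 - q" "2 - s"] ratio[of 3 "2 - q" "2 - s"] by auto
    next
      case 2
      then show ?thesis
        using assms ghost_inside[of q] ghost_inside[of s] velocity[of p q s] ratio[of p q s] by auto
    next
      case 3
      then show ?thesis
        using assms N ghost_right[of q] ghost_right[of s]
          velocity[of "int N" "2 * int N - q" "2 * int N - s"]
          ratio[of "int N" "2 * int N - q" "2 * int N - s"] by auto
    qed
  qed
  then show "\<bar>w q\<bar> \<le> M s / 4" "M q \<le> 23/20 * M s"
    using h D by (auto simp: w_def abs_mult field_simps)
qed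

text \<open>\<open>c\<close> and \<open>d\<close> are the stencils at odd and even points; the suffixes \<open>L\<close> and \<open>R\<close> refer to
  the left and right neighbours.\<close>

definition "cL2 p = R * (- w (p-2) / 4 + (3 * M (p-2) - 4 * M (p-1) + 3 * M p) / 8)"
definition "cL1 p = R * (w (p-1) - (M (p-2) + 3 * M p) / 2)"
definition "c0 p = M p + R * (M (p-2) + 4 * M (p-1) + 18 * M p + 4 * M (p+1) + M (p+2)) / 8"
definition "cR1 p = R * (- w (p+1) - (M (p+2) + 3 * M p) / 2)"
definition "cR2 p = R * (w (p+2) / 4 + (3 * M (p+2) - 4 * M (p+1) + 3 * M p) / 8)"
definition "dL p = R * (w (p-1) / 2 - (3 * M (p-1) + M (p+1)) / 4)"
definition "d0 p = M p + R * (M (p-1) + M (p+1))"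
definition "dR p = R * (- w (p+1) / 2 - (3 * M (p+1) + M (p-1)) / 4)"

text \<open>\<open>R * w q = dt * U q / h\<close> puts convection and diffusion over the common
  factor \<open>R\<close>.\<close>

lemma scheme_odd:
  assumes "odd p"
  shows "scheme_lhs D dt h M U g p =
    cL2 p * g (p-2) + cL1 p * g (p-1) + c0 p * g p + cR1 p * g (p+1) + cR2 p * g (p+2)"
  using assms h D
  unfolding scheme_lhs_def cL2_def cL1_def c0_def cR1_def cR2_def R_def w_def
  by (simp add: field_simps power2_eq_square)

lemma scheme_even:
  assumes "even p"
  shows "scheme_lhs D dt h M U g p = dL p * g (p-1) + d0 p * g p + dR p * g (p+1)"
  using assms h D
  unfolding scheme_lhs_def dL_def d0_def dR_def R_def w_def
  by (simp add: field_simps power2_eq_square)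

text \<open>The path from \<open>p\<close> over the midpoint \<open>p-1\<close> to
  \<open>p-2\<close> must outweigh the direct entry \<open>cL2 p\<close>. This is
  \<open>cell_inequality\<close> with \<open>a, b, c\<close> the values at
  \<open>p-2, p-1, p\<close>; for \<open>p = 1\<close> the cell is a ghost cell.\<close>

lemma cell_left:
  assumes "odd p" "1 \<le> p" "p \<le> int N"
  shows "cL1 p \<le> 0" "dL (p-1) \<le> 0" "cL2 p * d0 (p-1) \<le> cL1 p * dL (p-1)"
proof -
  \<comment> \<open>The minimum is attained at a point \<open>s\<close> of the cell, so
    \<open>cell\<close> at this \<open>s\<close> bounds all values and velocities there by
    \<open>m\<close>.\<close>
  define m where "m = Min {M (p-2), M (p-1), M p}"
  have "m \<in> {M (p-2), M (p-1), M p}" unfolding m_def by (rule Min_in) auto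
  also have "\<dots> \<subseteq> M ` {p-2..p}" by (auto intro!: imageI)
  finally obtain s where s: "s \<in> {p-2..p}" "m = M s" by auto
  have m: "m > 0" using M_pos[of s] s assms by auto
  have le: "m \<le> M (p-2)" "m \<le> M (p-1)" "m \<le> M p" by (auto simp: m_def)
  have ub: "M q \<le> 23/20 * m" and wq: "\<bar>w q\<bar> \<le> m / 4" if "q \<in> {p-2..p}" for q
    using cell[of p q s] assms s that by auto
  have wb: "- m / 4 \<le> w q \<and> w q \<le> m / 4" if "q \<in> {p-2..p}" for q
    using wq[OF that] by (auto simp: abs_le_iff)
  have shift: "p - 1 - 1 = p - 2" "p - 1 + 1 = p" by auto
  have "w (p-1) - (M (p-2) + 3 * M p) / 2 \<le> 0" "w (p-2) / 2 - (3 * M (p-2) + M p) / 4 \<le> 0"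
    using m le wb[of "p-1"] wb[of "p-2"] by simp_all
  then show "cL1 p \<le> 0" "dL (p-1) \<le> 0"
    using R unfolding cL1_def dL_def shift by (auto intro: mult_nonneg_nonpos)
  show "cL2 p * d0 (p-1) \<le> cL1 p * dL (p-1)"
    using cell_inequality[OF R m le(1,2,3) ub ub ub wq wq, of "p-2" "p-1"]
    unfolding cL2_def d0_def cL1_def dL_def shift by simp
qed

text \<open>The mirror image of the left case: the cell is read from right to left and the velocity
  changes sign.\<close>

lemma cell_right:
  assumes "odd p" "1 \<le> p" "p \<le> int N"
  shows "cR1 p \<le> 0" "dR (p+1) \<le> 0" "cR2 p * d0 (p+1) \<le> cR1 p * dR (p+1)"
proof -
  define m where "m = Min {M (p+2), M (p+1), M p}"
  have "m \<in> {M (p+2), M (p+1), M p}" unfolding m_def by (rule Min_in) auto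
  also have "\<dots> \<subseteq> M ` {p..p+2}" by (auto intro!: imageI)
  finally obtain s where s: "s \<in> {p..p+2}" "m = M s" by auto
  have m: "m > 0" using M_pos[of s] s assms by auto
  have le: "m \<le> M (p+2)" "m \<le> M (p+1)" "m \<le> M p" by (auto simp: m_def)
  have ub: "M q \<le> 23/20 * m" and wq: "\<bar>w q\<bar> \<le> m / 4" if "q \<in> {p..p+2}" for q
    using cell[of "p+2" q s] assms s that by auto
  have wb: "- m / 4 \<le> w q \<and> w q \<le> m / 4" if "q \<in> {p..p+2}" for q
    using wq[OF that] by (auto simp: abs_le_iff)
  have shift: "p + 1 + 1 = p + 2" "p + 1 - 1 = p" by auto
  have "- w (p+1) - (M (p+2) + 3 * M p) / 2 \<le> 0" "- w (p+2) / 2 - (3 * M (p+2) + M p) / 4 \<le> 0"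
    using conjunct1[OF wb[of "p+1"]] conjunct1[OF wb[of "p+2"]] m le by (auto simp: field_simps)
  then show "cR1 p \<le> 0" "dR (p+1) \<le> 0"
    using R unfolding cR1_def dR_def shift by (auto intro: mult_nonneg_nonpos)
  have wq': "\<bar>- w q\<bar> \<le> m / 4" if "q \<in> {p..p+2}" for q using wq[OF that] by simp
  show "cR2 p * d0 (p+1) \<le> cR1 p * dR (p+1)"
    using cell_inequality[OF R m le(1,2,3) ub ub ub wq' wq', of "p+2" "p+1"]
    unfolding cR2_def d0_def cR1_def dR_def shift by (simp add: add.commute)
qed

section \<open>Matrix entries in grid indices\<close>

text \<open>Rows and columns are numbered by grid points, as integers starting from 1, so that
  reflected indices can be inserted.\<close>

definition E :: "int \<Rightarrow> int \<Rightarrow> real" where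
  "E p q = scheme_lhs D dt h M U (ghost_even (int N) (\<lambda>l. if l = q then 1 else 0)) p"

text \<open>Near the boundary several stencil points are reflected to the same column, such as -1
  and 3 in row 1; a sum of indicators adds up their coefficients without case distinctions.\<close>

lemma E_odd: "odd p \<Longrightarrow> E p q =
    cL2 p * of_bool (r (p-2) = q) + cL1 p * of_bool (r (p-1) = q) + c0 p * of_bool (r p = q)
    + cR1 p * of_bool (r (p+1) = q) + cR2 p * of_bool (r (p+2) = q)"
  by (simp add: E_def scheme_odd ghost_even_def)

lemma E_even: "even p \<Longrightarrow> E p q =
    dL p * of_bool (r (p-1) = q) + d0 p * of_bool (r p = q) + dR p * of_bool (r (p+1) = q)"
  by (simp add: E_def scheme_even ghost_even_def)

lemma E_odd_even:
  assumes "odd p" "even q"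
  shows "E p q = cL1 p * of_bool (r (p-1) = q) + cR1 p * of_bool (r (p+1) = q)"
proof -
  have "r (p-2) \<noteq> q" "r p \<noteq> q" "r (p+2) \<noteq> q"
    using assms even_reflect[of "int N"] by (metis even_add even_diff even_numeral)+
  then show ?thesis by (simp add: E_odd assms)
qed

lemma E_odd_odd:
  assumes "odd p" "odd q" "1 \<le> p" "p \<le> int N" "p \<noteq> q"
  shows "E p q = cL2 p * of_bool (r (p-2) = q) + cR2 p * of_bool (r (p+2) = q)"
proof -
  have "r (p-1) \<noteq> q" "r (p+1) \<noteq> q"
    using assms even_reflect[of "int N"] by (metis even_add even_diff odd_one)+
  then show ?thesis using assms by (simp add: E_odd reflect_id)
qed

lemma even_row:
  assumes "even p" "1 \<le> p" "p \<le> int N"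
  shows "1 < p" "p < int N"
  using assms N by (auto simp: order_less_le)

lemma E_even_row:
  assumes "even p" "1 \<le> p" "p \<le> int N"
  shows "E p q = dL p * of_bool (p-1 = q) + d0 p * of_bool (p = q) + dR p * of_bool (p+1 = q)"
  using even_row[OF assms] assms by (simp add: E_even reflect_id)

lemma d0_pos: "0 \<le> p \<Longrightarrow> p \<le> int N + 1 \<Longrightarrow> d0 p > 0"
  using R M_pos[of p] M_pos[of "p-1"] M_pos[of "p+1"]
  unfolding d0_def by (intro add_pos_nonneg mult_nonneg_nonneg) auto

lemma E_diag:
  assumes "1 \<le> p" "p \<le> int N"
  shows "E p p > 0"
proof (cases "even p")
  case True
  then show ?thesis using assms d0_pos[of p] by (simp add: E_even_row)
next
  case False
  have "r (p-1) \<noteq> p" "r (p+1) \<noteq> p" using False even_reflect[of "int N"]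
    by (metis even_add even_diff odd_one)+
  \<comment> \<open>\<open>4 - p = p\<close> or \<open>2 * N - p - 2 = p\<close> would force
    \<open>p = 2\<close> or \<open>p = N - 1\<close>, both even.\<close>
  moreover have "r (p-2) \<noteq> p" "r (p+2) \<noteq> p"
    using False assms N by (auto simp: reflect_def) presburger+
  moreover have "c0 p > 0"
    using R M_pos[of p] M_pos[of "p-1"] M_pos[of "p+1"] M_pos[of "p-2"] M_pos[of "p+2"] assms
    unfolding c0_def by (intro add_pos_nonneg divide_nonneg_nonneg mult_nonneg_nonneg) auto
  ultimately show ?thesis using False assms by (simp add: E_odd reflect_id)
qed

lemma E_even_nonpos:
  assumes "even p" "1 \<le> p" "p \<le> int N" "p \<noteq> q"
  shows "E p q \<le> 0"
  using cell_left(2)[of "p+1"] cell_right(2)[of "p-1"] even_row[OF assms(1-3)] assms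
  by (simp add: E_even_row)

lemma E_odd_nonpos:
  assumes "odd p" "even q" "1 \<le> p" "p \<le> int N"
  shows "E p q \<le> 0"
  using cell_left(1)[of p] cell_right(1)[of p] assms by (simp add: E_odd_even)

lemma w_left: "w (- 1) = - w 3" and w_right: "w (int N + 2) = - w (int N - 2)"
  using N by (auto simp: w_def ghost_odd_def reflect_def)

lemma M_left: "M (- 1) = M 3" "M 0 = M 2" and M_right: "M (int N + 2) = M (int N - 2)" "M (int N + 1) = M (int N - 1)"
  using N by (auto simp: ghost_even_def reflect_def)

text \<open>For \<open>p = 1\<close> the neighbours 0 and -1 are ghost points standing for 2 and 3.
  The stencil at 0 mirrors the one at 2, with \<open>dL 0 = dR 2\<close>, because \<open>M\<close>
  is extended evenly and the velocity oddly.\<close>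

lemma E_reflect_left:
  assumes "odd p" "1 \<le> p" "p \<le> int N"
  shows "E (r (p-1)) (r (p-2)) = dL (p-1)" "E (r (p-1)) (r (p-1)) = d0 (p-1)"
proof -
  have "p = 1 \<or> p \<ge> 3" using assms by presburger
  then have "E (r (p-1)) (r (p-2)) = dL (p-1) \<and> E (r (p-1)) (r (p-1)) = d0 (p-1)"
  proof
    assume "p = 1"
    moreover have "E 2 3 = dL 0" "E 2 2 = d0 0"
      using N by (simp_all add: E_even_row dL_def dR_def d0_def w_left M_left)
    ultimately show ?thesis by (simp add: reflect_def)
  qed (use assms in \<open>simp add: reflect_id E_even_row\<close>)
  then show "E (r (p-1)) (r (p-2)) = dL (p-1)" "E (r (p-1)) (r (p-1)) = d0 (p-1)" by auto
qed

lemma E_reflect_right: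
  assumes "odd p" "1 \<le> p" "p \<le> int N"
  shows "E (r (p+1)) (r (p+2)) = dR (p+1)" "E (r (p+1)) (r (p+1)) = d0 (p+1)"
proof -
  have "p = int N \<or> p \<le> int N - 2" using assms N by presburger
  then have "E (r (p+1)) (r (p+2)) = dR (p+1) \<and> E (r (p+1)) (r (p+1)) = d0 (p+1)"
  proof
    assume "p = int N"
    moreover have "E (int N - 1) (int N - 2) = dR (int N + 1)" "E (int N - 1) (int N - 1) = d0 (int N + 1)"
      using N by (simp_all add: E_even_row dL_def dR_def d0_def w_right M_right
          w_right[unfolded add.commute[of "int N"]] M_right[unfolded add.commute[of "int N"]])
    ultimately show ?thesis by (simp add: reflect_def)
  qed (use assms in \<open>simp add: reflect_id E_even_row\<close>)
  then show "E (r (p+1)) (r (p+2)) = dR (p+1)" "E (r (p+1)) (r (p+1)) = d0 (p+1)" by auto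
qed

text \<open>The two outer coefficients are bounded separately, each by the path through the midpoint
  of its own cell. If that path does not end in \<open>q\<close>, the product on the right is still
  nonnegative. In rows 1 and \<open>N\<close> both coefficients fall on one column and the bounds
  add.\<close>

lemma E_odd_bound:
  assumes p: "odd p" "1 \<le> p" "p \<le> int N" and q: "odd q" "1 \<le> q" "q \<le> int N" "p \<noteq> q"
  shows "E p q \<le> cL1 p * (E (r (p-1)) q / E (r (p-1)) (r (p-1)))
    + cR1 p * (E (r (p+1)) q / E (r (p+1)) (r (p+1)))"
proof -
  have rr: "even (r (p-1))" "1 \<le> r (p-1)" "r (p-1) \<le> int N"
      "even (r (p+1))" "1 \<le> r (p+1)" "r (p+1) \<le> int N"
    using p N reflect_range[of "int N" "p-1"] reflect_range[of "int N" "p+1"]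
    by (auto simp: even_reflect)
  have d: "d0 (p-1) > 0" "d0 (p+1) > 0" using p by (auto intro!: d0_pos)
  have "cL2 p * of_bool (r (p-2) = q) \<le> cL1 p * (E (r (p-1)) q / E (r (p-1)) (r (p-1)))"
  proof (cases "r (p-2) = q")
    case True
    then show ?thesis
      using cell_left(3)[OF p] d E_reflect_left[OF p] by (auto simp: pos_le_divide_eq)
  next
    case False
    have "r (p-1) \<noteq> q" using rr q by auto
    then have "E (r (p-1)) q \<le> 0" by (intro E_even_nonpos rr)
    then have "E (r (p-1)) q / E (r (p-1)) (r (p-1)) \<le> 0"
      using d E_reflect_left[OF p] by (intro divide_nonpos_pos) auto
    from mult_nonpos_nonpos[OF cell_left(1)[OF p] this] show ?thesis using False by simp
  qed
  moreover have "cR2 p * of_bool (r (p+2) = q) \<le> cR1 p * (E (r (p+1)) q / E (r (p+1)) (r (p+1)))"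
  proof (cases "r (p+2) = q")
    case True
    then show ?thesis
      using cell_right(3)[OF p] d E_reflect_right[OF p] by (auto simp: pos_le_divide_eq)
  next
    case False
    have "r (p+1) \<noteq> q" using rr q by auto
    then have "E (r (p+1)) q \<le> 0" by (intro E_even_nonpos rr)
    then have "E (r (p+1)) q / E (r (p+1)) (r (p+1)) \<le> 0"
      using d E_reflect_right[OF p] by (intro divide_nonpos_pos) auto
    from mult_nonpos_nonpos[OF cell_right(1)[OF p] this] show ?thesis using False by simp
  qed
  ultimately show ?thesis using p q by (simp add: E_odd_odd)
qed

text \<open>The row sum is the scheme at the constant 1, since the reflected unit vectors add up to
  1 on the stencil. There the diffusion terms cancel and hypothesis (a) is left.\<close>

lemma E_row_sum:
  assumes p: "1 \<le> p" "p \<le> int N"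
  shows "(\<Sum>j<N. E p (int j + 1)) > 0"
proof -
  have one: "(\<Sum>j<N. 1 * ghost_even (int N) (\<lambda>l. if l = int j + 1 then 1 else 0) l) = (1::real)"
    if "l \<in> {p-2..p+2}" for l
  proof -
    have "1 \<le> r l" "r l \<le> int N" using that p N reflect_range[of "int N" l] by auto
    then have "(\<Sum>j<N. if r l = int j + 1 then 1 else 0) = (\<Sum>j<N. if j = nat (r l - 1) then 1 else (0::real))"
      by (intro sum.cong) auto
    also have "\<dots> = 1" using \<open>1 \<le> r l\<close> \<open>r l \<le> int N\<close> by (subst sum.delta) auto
    finally show ?thesis by (simp add: ghost_even_def)
  qed
  have "(\<Sum>j<N. E p (int j + 1)) = (\<Sum>j<N. 1 * scheme_lhs D dt h M U
      (ghost_even (int N) (\<lambda>l. if l = int j + 1 then 1 else 0)) p)"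
    by (simp add: E_def)
  also have "\<dots> = scheme_lhs D dt h M U (\<lambda>_. 1) p"
    unfolding scheme_lhs_sum[symmetric] by (rule scheme_lhs_cong[OF one])
  also have "\<dots> > 0"
  proof (cases "even p")
    case True
    have "scheme_lhs D dt h M U (\<lambda>_. 1) p = M p + dt * ((U (p-1) - U (p+1)) / (2 * h))"
      using True h by (simp add: scheme_lhs_def algebra_simps)
    then show ?thesis using even_sum[OF True p] by simp
  next
    case False
    have "cL2 p + cL1 p + c0 p + cR1 p + cR2 p
      = M p + R * ((- w (p-2) + 4 * w (p-1) - 4 * w (p+1) + w (p+2)) / 4)"
      unfolding cL2_def cL1_def c0_def cR1_def cR2_def by (simp add: field_simps)
    also have "R * ((- w (p-2) + 4 * w (p-1) - 4 * w (p+1) + w (p+2)) / 4)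
      = dt * ((- U (p-2) + 4 * U (p-1) - 4 * U (p+1) + U (p+2)) / (4 * h))"
      unfolding R_def w_def using h D by (simp add: field_simps power2_eq_square)
    finally have "scheme_lhs D dt h M U (\<lambda>_. 1) p
        = M p + dt * ((- U (p-2) + 4 * U (p-1) - 4 * U (p+1) + U (p+2)) / (4 * h))"
      using False by (simp add: scheme_odd)
    then show ?thesis using odd_sum[OF False p] by simp
  qed
  finally show ?thesis .
qed

sublocale two_colour "coeff_mat N D dt h M U" N even
proof
  have E: "coeff_mat N D dt h M U $$ (i, j) = E (int i + 1) (int j + 1)" if "i < N" "j < N" for i j
    using that by (simp add: coeff_mat_def E_def)
  show "coeff_mat N D dt h M U \<in> carrier_mat N N" by (simp add: coeff_mat_def)
  show "N > 0" using N by simp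
  show "0 < coeff_mat N D dt h M U $$ (i, i)" if "i < N" for i
    using that by (simp add: E E_diag)
  show "coeff_mat N D dt h M U $$ (i, j) \<le> 0" if "i < N" "j < N" "even i" "odd j" for i j
    using that by (simp add: E E_odd_nonpos)
  show "coeff_mat N D dt h M U $$ (i, j) \<le> 0" if "i < N" "j < N" "odd i" "i \<noteq> j" for i j
    using that by (simp add: E E_even_nonpos)
  show "0 < (\<Sum>j<N. coeff_mat N D dt h M U $$ (i, j))" if "i < N" for i
    using that E_row_sum[of "int i + 1"] by (simp add: E)
  fix i j assume i: "i < N" and j: "j < N" and ij: "even i" "even j" "i \<noteq> j"
  let ?S = "{l. l < N \<and> odd l}" and ?p = "int i + 1" and ?q = "int j + 1"
  define F where "F s = E s ?q / E s s" for s
  \<comment> \<open>The sum over all midpoints collapses to the reflected neighbours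
    \<open>r (?p-1)\<close> and \<open>r (?p+1)\<close>; two separate sums also cover the rows in
    which these coincide.\<close>
  have delta: "(\<Sum>l\<in>?S. c * of_bool (s = int l + 1) * F (int l + 1)) = c * F s"
    if s: "even s" "1 \<le> s" "s \<le> int N" for s c
  proof -
    have "(\<Sum>l\<in>?S. c * of_bool (s = int l + 1) * F (int l + 1))
        = (\<Sum>l\<in>?S. if l = nat (s - 1) then c * F s else 0)"
      using s by (intro sum.cong) auto
    moreover have "nat (s - 1) \<in> ?S" using s by (auto simp: even_nat_iff)
    ultimately show ?thesis by (simp add: sum.delta)
  qed
  have rr: "even (r (?p-1))" "1 \<le> r (?p-1)" "r (?p-1) \<le> int N"
      "even (r (?p+1))" "1 \<le> r (?p+1)" "r (?p+1) \<le> int N"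
    using i ij N reflect_range[of "int N" "?p-1"] reflect_range[of "int N" "?p+1"]
    by (auto simp: even_reflect)
  have "E ?p ?q \<le> cL1 ?p * F (r (?p-1)) + cR1 ?p * F (r (?p+1))"
    unfolding F_def using i j ij by (intro E_odd_bound) auto
  also have "\<dots> = (\<Sum>l\<in>?S. cL1 ?p * of_bool (r (?p-1) = int l + 1) * F (int l + 1))
      + (\<Sum>l\<in>?S. cR1 ?p * of_bool (r (?p+1) = int l + 1) * F (int l + 1))"
    by (simp only: delta rr)
  also have "\<dots> = (\<Sum>l\<in>?S. E ?p (int l + 1) * F (int l + 1))"
    unfolding sum.distrib[symmetric] using ij
    by (intro sum.cong refl) (simp add: E_odd_even algebra_simps)
  also have "\<dots> = (\<Sum>l\<in>?S. coeff_mat N D dt h M U $$ (i, l) * coeff_mat N D dt h M U $$ (l, j)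
      / coeff_mat N D dt h M U $$ (l, l))"
    using i j by (intro sum.cong) (auto simp: E F_def)
  finally show "coeff_mat N D dt h M U $$ (i, j) \<le> (\<Sum>l | l < N \<and> odd l.
      coeff_mat N D dt h M U $$ (i, l) * coeff_mat N D dt h M U $$ (l, j)
      / coeff_mat N D dt h M U $$ (l, l))"
    using i j by (simp add: E)
qed

end

section \<open>Variation of the coefficient function over a cell\<close>

text \<open>The mean value theorem; continuity of \<open>f'\<close> on a compact interval makes its
  absolute values bounded, so that the supremum is a genuine upper bound.\<close>

lemma bounded_slope_SUP:
  fixes f f' :: "real \<Rightarrow> real"
  assumes deriv: "\<And>y. y \<in> {lo..hi} \<Longrightarrow> (f has_real_derivative f' y) (at y within {lo..hi})"
    and cont: "continuous_on {lo..hi} f'"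
    and ab: "lo \<le> a" "b \<le> hi" and s: "s \<in> {a..b}" and t: "t \<in> {a..b}"
  shows "\<bar>f s - f t\<bar> \<le> (SUP y\<in>{a..b}. \<bar>f' y\<bar>) * \<bar>s - t\<bar>"
proof -
  let ?g = "\<lambda>y. \<bar>f' y\<bar>"
  have "continuous_on {a..b} ?g"
    using ab by (intro continuous_on_rabs continuous_on_subset[OF cont]) auto
  moreover have "{a..b} \<noteq> {}" using s by auto
  ultimately obtain z where "\<forall>y\<in>{a..b}. ?g y \<le> ?g z"
    using continuous_attains_sup[of "{a..b}" ?g] compact_Icc by blast
  then have bdd: "bdd_above (?g ` {a..b})" by (auto intro: bdd_aboveI2)
  have less: "\<bar>f t - f s\<bar> \<le> (SUP y\<in>{a..b}. ?g y) * \<bar>t - s\<bar>"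
    if st: "s < t" "s \<in> {a..b}" "t \<in> {a..b}" for s t
  proof -
    have "continuous_on {s..t} f"
    proof (rule DERIV_continuous_on)
      fix y assume "y \<in> {s..t}"
      then show "(f has_real_derivative f' y) (at y within {s..t})"
        using st ab by (intro DERIV_subset[OF deriv[of y]]) auto
    qed
    moreover have "(f has_derivative (*) (f' y)) (at y)" if "s < y" "y < t" for y
      using deriv[of y] that st ab by (simp add: has_field_derivative_def at_within_Icc_at)
    ultimately obtain y where y: "s < y" "y < t" "f t - f s = f' y * (t - s)"
      using mvt[OF st(1), of f "\<lambda>y. (*) (f' y)"] by blast
    have "\<bar>f' y\<bar> \<le> (SUP y\<in>{a..b}. ?g y)"
      using y st by (intro cSUP_upper bdd) auto
    then show ?thesis by (simp add: y(3) abs_mult mult_right_mono)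
  qed
  show ?thesis
    using less[of s t] less[of t s] s t by (cases s t rule: linorder_cases) (auto simp: abs_minus_commute)
qed

section \<open>From the given data to the grid\<close>

theorem theorem3p6:
  fixes k N :: nat and L h D dt \<epsilon>\<^sub>0 :: real
    and \<M> \<M>' u :: "real \<Rightarrow> real"
    and x M U :: "int \<Rightarrow> real" and A :: "real mat"
  assumes k: "k \<ge> 1" and h: "h > 0" and partition: "real k * (2 * h) = 2 * L"
    and N: "N = 2 * k + 1"
    and x: "x = (\<lambda>i. - L + real_of_int (i - 1) * h)"
    and D: "D > 0" and dt: "dt > 0"
    and \<epsilon>: "\<epsilon>\<^sub>0 > 0" and \<M>_ge: "\<forall>y \<in> {-L..L}. \<M> y \<ge> \<epsilon>\<^sub>0"
    and \<M>_deriv: "\<forall>y \<in> {-L..L}. (\<M> has_real_derivative \<M>' y) (at y within {-L..L})"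
    and \<M>_C1: "continuous_on {-L..L} \<M>'"
    and bc: "u (x 1) = 0" "u (x (int N)) = 0"
    and M: "M = ghost_even (int N) (\<lambda>i. \<M> (x i))"
    and U: "U = ghost_odd (int N) (\<lambda>i. u (x i))"
    and A: "A = coeff_mat N D dt h M U"
  shows
    "((\<forall>i \<in> {1..int N}. odd i \<longrightarrow>
         M i + dt * ((- U (i-2) + 4 * U (i-1) - 4 * U (i+1) + U (i+2)) / (4 * h)) > 0) \<and>
      (\<forall>i \<in> {1..int N}. even i \<longrightarrow> M i + dt * ((U (i-1) - U (i+1)) / (2 * h)) > 0) \<and>
      (\<forall>i \<in> {3..int N}. odd i \<longrightarrow>
         h * Max {\<bar>U (i-2)\<bar>, \<bar>U (i-1)\<bar>, \<bar>U i\<bar>} \<le> 1/4 * D * Min {M (i-2), M (i-1), M i}) \<and>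
      (\<forall>i \<in> {3..int N}. odd i \<longrightarrow>
         h * (SUP y \<in> {x (i-2)..x i}. \<bar>\<M>' y\<bar>) \<le> 0.075 * Min {M (i-2), M (i-1), M i}) \<and>
      dt / h\<^sup>2 \<ge> 50 / D
      \<longrightarrow>
      lorenz_conditions A \<and>
      (\<exists>M1 \<in> carrier_mat N N. \<exists>M2 \<in> carrier_mat N N.
         nonsing_M_matrix M1 \<and> nonsing_M_matrix M2 \<and> A = M1 * M2) \<and>
      monotone_mat A)
     \<and>
     ((\<forall>i \<in> {1..int N}. discrete_div h U i = 0) \<and>
      dt / h\<^sup>2 \<ge> 50 / D \<and>
      (\<forall>i \<in> {1..int N - 2}. odd i \<longrightarrow>
         h * Max {\<bar>U i\<bar>, \<bar>U (i+1)\<bar>, \<bar>U (i+2)\<bar>} \<le> 1/4 * D * Min {M i, M (i+1), M (i+2)}) \<and>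
      (\<forall>i \<in> {1..int N - 2}. odd i \<longrightarrow>
         h * (SUP y \<in> {x i..x (i+2)}. \<bar>\<M>' y\<bar>) \<le> 0.075 * Min {M i, M (i+1), M (i+2)})
      \<longrightarrow>
      (\<exists>c. \<forall>i \<in> {1..int N}. u (x i) = c) \<and>
      monotone_mat A)"
proof -
  define f where "f i = \<M> (x i)" for i
  define v where "v i = u (x i)" for i
  have Nk: "odd N" "N \<ge> 3" using N k by auto
  have L: "2 * L = real_of_int (int N - 1) * h" using partition N by simp
  have x_mono: "x i \<le> x j" if "i \<le> j" for i j
    using that h by (simp add: x mult_right_mono)
  have x1: "x 1 = - L" and xN: "x (int N) = L" using L by (simp_all add: x)
  have x_mem: "x i \<in> {-L..L}" if "1 \<le> i" "i \<le> int N" for i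
    using x_mono[OF that(1)] x_mono[OF that(2)] x1 xN by simp
  have f_pos: "f i > 0" if "1 \<le> i" "i \<le> int N" for i
    using bspec[OF \<M>_ge x_mem[OF that]] \<epsilon> by (simp add: f_def)
  have v_bc: "v 1 = 0" "v (int N) = 0" using bc by (simp_all add: v_def)
  have M_f: "M = ghost_even (int N) f" unfolding M f_def ..
  have U_v: "U = ghost_odd (int N) v" unfolding U v_def ..
  have M_in: "M i = f i" and U_in: "U i = v i" if "1 \<le> i" "i \<le> int N" for i
    using that by (auto simp: M_f U_v ghost_even_def ghost_odd_def reflect_def)
  \<comment> \<open>This is the first claim; the second one reuses it with zero velocity.\<close>
  have main: "lorenz_conditions A \<and>
      (\<exists>M1 \<in> carrier_mat N N. \<exists>M2 \<in> carrier_mat N N.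
         nonsing_M_matrix M1 \<and> nonsing_M_matrix M2 \<and> A = M1 * M2) \<and>
      monotone_mat A"
    if a_odd: "\<And>i. 1 \<le> i \<Longrightarrow> i \<le> int N \<Longrightarrow> odd i \<Longrightarrow>
         M i + dt * ((- U (i-2) + 4 * U (i-1) - 4 * U (i+1) + U (i+2)) / (4 * h)) > 0"
      and a_even: "\<And>i. 1 \<le> i \<Longrightarrow> i \<le> int N \<Longrightarrow> even i \<Longrightarrow>
         M i + dt * ((U (i-1) - U (i+1)) / (2 * h)) > 0"
      and b: "\<And>i. 3 \<le> i \<Longrightarrow> i \<le> int N \<Longrightarrow> odd i \<Longrightarrow>
         h * Max {\<bar>U (i-2)\<bar>, \<bar>U (i-1)\<bar>, \<bar>U i\<bar>} \<le> 1/4 * D * Min {M (i-2), M (i-1), M i}"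
      and c: "\<And>i. 3 \<le> i \<Longrightarrow> i \<le> int N \<Longrightarrow> odd i \<Longrightarrow>
         h * (SUP y \<in> {x (i-2)..x i}. \<bar>\<M>' y\<bar>) \<le> 0.075 * Min {M (i-2), M (i-1), M i}"
      and d: "dt / h\<^sup>2 \<ge> 50 / D"
  proof -
    have min: "Min {M (p-2), M (p-1), M p} \<le> f s"
      and max: "\<bar>v s\<bar> \<le> Max {\<bar>U (p-2)\<bar>, \<bar>U (p-1)\<bar>, \<bar>U p\<bar>}"
      if p: "3 \<le> p" "p \<le> int N" and s: "s \<in> {p-2..p}" for p s
    proof -
      have "s = p-2 \<or> s = p-1 \<or> s = p" using s by auto
      moreover have "M s = f s" "U s = v s" using p s M_in U_in by auto
      ultimately have "f s \<in> {M (p-2), M (p-1), M p}"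
        "\<bar>v s\<bar> \<in> {\<bar>U (p-2)\<bar>, \<bar>U (p-1)\<bar>, \<bar>U p\<bar>}" by auto
      then show "Min {M (p-2), M (p-1), M p} \<le> f s"
        "\<bar>v s\<bar> \<le> Max {\<bar>U (p-2)\<bar>, \<bar>U (p-1)\<bar>, \<bar>U p\<bar>}"
        by (auto intro: Min_le Max_ge simp del: Min_insert Max_insert)
    qed
    have velocity: "h * \<bar>v q\<bar> \<le> D / 4 * f s"
      if p: "odd p" "3 \<le> p" "p \<le> int N" "q \<in> {p-2..p}" "s \<in> {p-2..p}" for p q s
    proof -
      have "h * \<bar>v q\<bar> \<le> h * Max {\<bar>U (p-2)\<bar>, \<bar>U (p-1)\<bar>, \<bar>U p\<bar>}"
        using max[OF p(2-4)] h by (intro mult_left_mono) auto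
      also have "\<dots> \<le> 1/4 * D * Min {M (p-2), M (p-1), M p}" by (rule b[OF p(2,3,1)])
      also have "\<dots> \<le> 1/4 * D * f s"
        using min[OF p(2,3,5)] D by (intro mult_left_mono) auto
      finally show ?thesis by simp
    qed
    have ratio: "f q \<le> 23/20 * f s"
      if p: "odd p" "3 \<le> p" "p \<le> int N" "q \<in> {p-2..p}" "s \<in> {p-2..p}" for p q s
    proof -
      let ?S = "SUP y \<in> {x (p-2)..x p}. \<bar>\<M>' y\<bar>"
      have deriv: "(\<M> has_real_derivative \<M>' y) (at y within {-L..L})" if "y \<in> {-L..L}" for y
        using \<M>_deriv that by blast
      have "\<bar>f q - f s\<bar> \<le> ?S * \<bar>x q - x s\<bar>"
        unfolding f_def using p x_mem[of p] x_mem[of "p-2"]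
        by (intro bounded_slope_SUP[OF deriv \<M>_C1]) (auto intro!: x_mono)
      moreover have "\<bar>x q - x s\<bar> = \<bar>real_of_int (q - s)\<bar> * h"
        using h by (simp add: x abs_mult flip: left_diff_distrib)
      moreover have "\<bar>q - s\<bar> \<le> 2" using p by auto
      then have "\<bar>real_of_int (q - s)\<bar> \<le> 2" by linarith
      then have "\<bar>real_of_int (q - s)\<bar> * (h * ?S) \<le> 2 * (0.075 * f s)"
      proof (rule mult_mono)
        show "h * ?S \<le> 0.075 * f s" using c[OF p(2,3,1)] min[OF p(2,3,5)] by simp
        \<comment> \<open>The slope bound between the ends of the cell, which are
          \<open>2 * h > 0\<close> apart, shows that the supremum is nonnegative.\<close>
        have "0 \<le> ?S * \<bar>x (p-2) - x p\<bar>"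
          using p x_mem[of p] x_mem[of "p-2"]
            bounded_slope_SUP[OF deriv \<M>_C1, of "x (p-2)" "x p" "x (p-2)" "x p"] x_mono[of "p-2" p]
          by fastforce
        then show "0 \<le> h * ?S" using h by (simp add: x algebra_simps)
      qed simp
      ultimately show ?thesis by (simp add: mult_ac)
    qed
    have A_fv: "A = coeff_mat N D dt h (ghost_even (int N) f) (ghost_odd (int N) v)"
      unfolding A M_f U_v ..
    interpret grid_scheme N D dt h f v
      using Nk h D d f_pos velocity ratio a_odd a_even
      by unfold_locales (auto simp: M_f U_v)
    show ?thesis
      using lorenz monotone product_M_matrices unfolding A_fv by blast
  qed
  \<comment> \<open>The equations at even points carry \<open>U 1 = 0\<close> to all odd points. The
    equations at odd points then link the even ones, starting at point 1, where the ghost value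
    \<open>U 0 = - U 2\<close> leaves \<open>8 * U 2 = 0\<close>.\<close>
  have div_free: "U i = 0"
    if div: "\<And>i. 1 \<le> i \<Longrightarrow> i \<le> int N \<Longrightarrow> discrete_div h U i = 0"
      and i: "1 \<le> i" "i \<le> int N" for i
  proof -
    have odd_zero: "U (2 * int j + 1) = 0" if "2 * j + 1 \<le> N" for j
      using that
    proof (induction j)
      case 0
      then show ?case using v_bc by (simp add: U_in)
    next
      case (Suc j)
      have e: "2 * int j + 2 - 1 = 2 * int j + 1" "2 * int j + 2 + 1 = 2 * int (Suc j) + 1" by auto
      have "discrete_div h U (2 * int j + 2) = (U (2 * int j + 2 + 1) - U (2 * int j + 2 - 1)) / (2 * h)"
        by (simp add: discrete_div_def)
      then have "U (2 * int (Suc j) + 1) = U (2 * int j + 1)"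
        using Suc.prems div[of "2 * int j + 2"] h unfolding e by simp
      then show ?case using Suc by simp
    qed
    have odd_zero': "U p = 0" if "odd p" "1 \<le> p" "p \<le> int N" for p
    proof -
      have "p = 2 * int (nat ((p - 1) div 2)) + 1" using that by auto
      then show ?thesis using odd_zero[of "nat ((p - 1) div 2)"] that by force
    qed
    have even_zero: "U (2 * int j + 2) = 0" if "2 * j + 2 \<le> N" for j
      using that
    proof (induction j)
      case 0
      have "U (- 1) = - U 3" "U 0 = - U 2"
        using Nk by (auto simp: U_v ghost_odd_def reflect_def)
      moreover have "U 3 = 0" using odd_zero'[of 3] Nk by simp
      ultimately show ?case using div[of 1] Nk h by (simp add: discrete_div_def)
    next
      case (Suc j)
      let ?p = "2 * int j + 3"
      have e: "?p - 2 = 2 * int j + 1" "?p - 1 = 2 * int j + 2" "?p + 1 = 2 * int (Suc j) + 2"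
        by auto
      \<comment> \<open>\<open>N\<close> is odd, so \<open>2 * j + 4 <= N\<close> leaves room for
        the point \<open>2 * j + 5\<close>.\<close>
      have p: "?p + 2 \<le> int N" using Suc.prems Nk by presburger
      have "U (2 * int j + 1) = 0" "U (?p + 2) = 0"
        by (rule odd_zero'; use p in simp)+
      moreover have "discrete_div h U ?p = 0" using p by (intro div) auto
      moreover have "discrete_div h U ?p
          = (U (?p - 2) - 4 * U (?p - 1) + 4 * U (?p + 1) - U (?p + 2)) / (4 * h)"
        by (simp add: discrete_div_def)
      moreover have "U (2 * int j + 2) = 0" using Suc by simp
      ultimately show ?case using h unfolding e by simp
    qed
    show ?thesis
    proof (cases "odd i")
      case False
      then obtain l where "i = 2 * l" by (auto elim: evenE)
      then have "i = 2 * int (nat (l - 1)) + 2" using i by auto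
      then show ?thesis using even_zero[of "nat (l - 1)"] i by force
    qed (use odd_zero' i in auto)
  qed
  show ?thesis
  proof (intro conjI[OF impI impI], goal_cases)
    case 1
    then show ?case by (intro main) auto
  next
    case 2
    then have Ui: "U i = 0" if "1 \<le> i" "i \<le> int N" for i
      using div_free that by auto
    \<comment> \<open>With zero velocity at the ghost points too, hypothesis (a) reduces to
      \<open>M i > 0\<close>.\<close>
    have U0: "U i = 0" if "- 1 \<le> i" "i \<le> int N + 2" for i
    proof -
      have r: "1 \<le> reflect (int N) i" "reflect (int N) i \<le> int N"
        using that Nk reflect_range[of "int N" i] by auto
      show ?thesis using Ui[OF r] U_in[OF r] Ui[of i] by (auto simp: U_v ghost_odd_def)
    qed
    have "\<forall>i\<in>{1..int N}. u (x i) = 0"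
      using Ui U_in by (auto simp: v_def)
    moreover have "monotone_mat A"
    proof -
      have Mp: "M i > 0" if "1 \<le> i" "i \<le> int N" for i using that M_in f_pos by simp
      \<comment> \<open>The given bounds index a cell by its left end, \<open>main\<close> by its
        right end, hence the shift by 2.\<close>
      have "odd i \<Longrightarrow> 3 \<le> i \<Longrightarrow> i \<le> int N \<Longrightarrow>
          h * Max {\<bar>U (i-2)\<bar>, \<bar>U (i-1)\<bar>, \<bar>U i\<bar>} \<le> 1/4 * D * Min {M (i-2), M (i-1), M i} \<and>
          h * (SUP y \<in> {x (i-2)..x i}. \<bar>\<M>' y\<bar>) \<le> 0.075 * Min {M (i-2), M (i-1), M i}" for i
      proof -
        assume i: "odd i" "3 \<le> i" "i \<le> int N"
        have e: "i - 2 + 1 = i - 1" "i - 2 + 2 = i" by auto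
        have "i - 2 \<in> {1..int N - 2}" "odd (i - 2)" using i by auto
        with 2 have "h * Max {\<bar>U (i-2)\<bar>, \<bar>U (i-2+1)\<bar>, \<bar>U (i-2+2)\<bar>} \<le> 1/4 * D * Min {M (i-2), M (i-2+1), M (i-2+2)} \<and>
          h * (SUP y \<in> {x (i-2)..x (i-2+2)}. \<bar>\<M>' y\<bar>) \<le> 0.075 * Min {M (i-2), M (i-2+1), M (i-2+2)}"
          by blast
        then show ?thesis unfolding e .
      qed
      then show ?thesis
        using 2 by (intro main[THEN conjunct2, THEN conjunct2]) (auto simp: U0 Mp)
    qed
    ultimately show ?case by blast
  qed
qed

end
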